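(* Let $\mathbb{A}$ be a commutative ring with unit that is complete with respect to an ideal $\mathfrak{m}$, and let $Q$ be a rack such that $|\operatorname{Inn}(Q)|$ is invertible in $\mathbb{A}$. Then every Yang-Baxter deformation (with respect to $\mathfrak{m}$) of $c_Q\colon\mathbb{A}Q^2\to\mathbb{A}Q^2$, $x\otimes y\mapsto y\otimes(x\ast y)$, is equivalent (with respect to $\mathfrak{m}$) to an entropic deformation of $c_Q$.
   Context: Complete with respect to $\mathfrak{m}$ means that the natural map $\mathbb{A}\to\varprojlim\mathbb{A}/\mathfrak{m}^n$ is an isomorphism. All tensor products are over $\mathbb{A}$; $\mathrm{I}$ is the identity of a module $V$ and $\mathrm{II}=\mathrm{I}\otimes\mathrm{I}$. A rack is a set $Q$ with a binary operation $(x,y)\mapsto x\ast y=x^y$ such that every right translation $\varrho(y)\colon x\mapsto x\ast y$ is a bijection of $Q$ and $(x\ast y)\ast z=(x\ast z)\ast(y\ast z)$ for all $x,y,z$. $\operatorname{Inn}(Q)$ is the group of automorphisms of $Q$ generated by all $\varrho(y)$, $y\in Q$. $V=\mathbb{A}Q$ is the free $\mathbb{A}$-module with basis $Q$; $\mathbb{A}Q^n$ is identified with $V^{\otimes n}$. A Yang-Baxter operator on $V$ is an automorphism $c$ of $V\otimes V$ satisfying $(c\otimes\mathrm{I})(\mathrm{I}\otimes c)(c\otimes\mathrm{I})=(\mathrm{I}\otimes c)(c\otimes\mathrm{I})(\mathrm{I}\otimes c)$. A Yang-Baxter deformation of $c$ with respect to $\mathfrak{m}$ is a Yang-Baxter operator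 $\tilde c$ on $V$ with $\tilde c\equiv c$ modulo $\mathfrak{m}$. Two Yang-Baxter operators $c,\tilde c$ are equivalent with respect to $\mathfrak{m}$ if there is an automorphism $\alpha\colon V\to V$ with $\alpha\equiv\mathrm{I}$ modulo $\mathfrak{m}$ and $\tilde c=(\alpha\otimes\alpha)\,c\,(\alpha\otimes\alpha)^{-1}$. An $\mathbb{A}$-linear map $f\colon\mathbb{A}Q^n\to\mathbb{A}Q^n$ is entropic (with respect to $c_Q$) if for each $i=0,\dots,n$ one has, on $V^{\otimes(n+1)}$, $$(c_n\cdots c_{i+1})^{-1}(f\otimes\mathrm{I})(c_n\cdots c_{i+1})=(c_1\cdots c_i)^{-1}(\mathrm{I}\otimes f)(c_1\cdots c_i),$$ where $c_j=\mathrm{I}^{\otimes(j-1)}\otimes c_Q\otimes\mathrm{I}^{\otimes(n-j)}$ and products are compositions of maps (rightmost applied first). An entropic deformation of $c_Q$ (with respect to $\mathfrak{m}$) is a map $c=c_Qf$ (composition) with $f\colon\mathbb{A}Q^2\to\mathbb{A}Q^2$ entropic and $f\equiv\mathrm{II}$ modulo $\mathfrak{m}$.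
   Formalization: The free module AQ is also assumed complete with respect to m; this is automatic if Q is finite or m is nilpotent. For infinite Q and non-nilpotent m the claim as written can fail, e.g. over k[[t]] (char k ≠ 2) for an infinite rack x∗y=σ(x) with σ a fixed-point-free involution. *)

theory Defs
  imports Complex_Main "HOL-Library.Poly_Mapping" "HOL-Algebra.Bij" "HOL-Algebra.Generated_Groups"
begin

section \<open>Ideals, adic completeness, congruence of maps\<close>

text \<open>An ideal of a commutative ring is a submodule of the ring regarded as a module over itself.\<close>

abbreviation is_ideal :: "'a::comm_ring_1 set \<Rightarrow> bool" where
  "is_ideal I \<equiv> module.subspace (*) I"

fun ideal_power :: "'a::comm_ring_1 set \<Rightarrow> nat \<Rightarrow> 'a set" where
  "ideal_power I 0 = UNIV"
| "ideal_power I (Suc n) = module.span (*) {a * b |a b. a \<in> I \<and> b \<in> ideal_power I n}"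

text \<open>The submodule \<open>I M\<close> of a module \<open>M\<close> (a whole type) with scalar multiplication \<open>s\<close>.\<close>

definition ideal_times :: "('a::comm_ring_1 \<Rightarrow> 'b::ab_group_add \<Rightarrow> 'b) \<Rightarrow> 'a set \<Rightarrow> 'b set" where
  "ideal_times s I = module.span s {s a v |a v. a \<in> I}"

definition cong_rel :: "('a::comm_ring_1 \<Rightarrow> 'b::ab_group_add \<Rightarrow> 'b) \<Rightarrow> 'a set \<Rightarrow> ('b \<times> 'b) set" where
  "cong_rel s I = {(u, v). u - v \<in> ideal_times s I}"

text \<open>The inverse limit of the quotients \<open>M / m\<^sup>n M\<close>. Elements of a quotient are cosets, and the
  transition map sends a coset of \<open>m\<^sup>n\<^sup>+\<^sup>1 M\<close> to the coset of \<open>m\<^sup>n M\<close> that contains it.\<close>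

definition adic_limit ::
    "('a::comm_ring_1 \<Rightarrow> 'b::ab_group_add \<Rightarrow> 'b) \<Rightarrow> 'a set \<Rightarrow> (nat \<Rightarrow> 'b set) set" where
  "adic_limit s m =
     {F. (\<forall>n. F n \<in> UNIV // cong_rel s (ideal_power m n)) \<and> (\<forall>n. F (Suc n) \<subseteq> F n)}"

text \<open>Operations on the limit are defined on representatives, so the natural map is an
  isomorphism as soon as it is bijective. For the ring itself take \<open>s = (*)\<close>.\<close>

definition adic_complete :: "('a::comm_ring_1 \<Rightarrow> 'b::ab_group_add \<Rightarrow> 'b) \<Rightarrow> 'a set \<Rightarrow> bool" where
  "adic_complete s m \<longleftrightarrow>
     bij_betw (\<lambda>v n. cong_rel s (ideal_power m n) `` {v}) UNIV (adic_limit s m)"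


section \<open>Free modules and tensor products\<close>

text \<open>\<open>'x \<Rightarrow>\<^sub>0 'a\<close> is the free module with basis \<open>'x\<close>; the basis element belonging to \<open>x\<close> is
  \<open>fbasis x\<close>. The tensor product of the free modules on \<open>'x\<close> and \<open>'y\<close> is the free module on
  \<open>'x \<times> 'y\<close>.\<close>

definition fscale :: "'a::comm_ring_1 \<Rightarrow> ('x \<Rightarrow>\<^sub>0 'a) \<Rightarrow> ('x \<Rightarrow>\<^sub>0 'a)" where
  "fscale a v = Poly_Mapping.map ((*) a) v"

definition fbasis :: "'x \<Rightarrow> ('x \<Rightarrow>\<^sub>0 'a::comm_ring_1)" where
  "fbasis x = Poly_Mapping.single x 1"

definition fextend :: "('x \<Rightarrow> ('y \<Rightarrow>\<^sub>0 'a::comm_ring_1)) \<Rightarrow> ('x \<Rightarrow>\<^sub>0 'a) \<Rightarrow> ('y \<Rightarrow>\<^sub>0 'a)" where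
  "fextend \<phi> v = (\<Sum>x\<in>Poly_Mapping.keys v. fscale (Poly_Mapping.lookup v x) (\<phi> x))"

abbreviation flinear :: "(('x \<Rightarrow>\<^sub>0 'a::comm_ring_1) \<Rightarrow> ('y \<Rightarrow>\<^sub>0 'a)) \<Rightarrow> bool" where
  "flinear f \<equiv> module_hom fscale fscale f"

definition automorphism :: "(('x \<Rightarrow>\<^sub>0 'a::comm_ring_1) \<Rightarrow> ('x \<Rightarrow>\<^sub>0 'a)) \<Rightarrow> bool" where
  "automorphism f \<longleftrightarrow> flinear f \<and> bij f"

definition cong_maps ::
    "'a::comm_ring_1 set \<Rightarrow> (('x \<Rightarrow>\<^sub>0 'a) \<Rightarrow> ('y \<Rightarrow>\<^sub>0 'a)) \<Rightarrow> (('x \<Rightarrow>\<^sub>0 'a) \<Rightarrow> ('y \<Rightarrow>\<^sub>0 'a)) \<Rightarrow> bool" where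
  "cong_maps I f g \<longleftrightarrow> (\<forall>v. f v - g v \<in> ideal_times fscale I)"

definition tensor :: "('x \<Rightarrow>\<^sub>0 'a::comm_ring_1) \<Rightarrow> ('y \<Rightarrow>\<^sub>0 'a) \<Rightarrow> ('x \<times> 'y \<Rightarrow>\<^sub>0 'a)" where
  "tensor u v = (\<Sum>x\<in>Poly_Mapping.keys u. \<Sum>y\<in>Poly_Mapping.keys v.
      Poly_Mapping.single (x, y) (Poly_Mapping.lookup u x * Poly_Mapping.lookup v y))"

definition tensor_map ::
    "(('x \<Rightarrow>\<^sub>0 'a::comm_ring_1) \<Rightarrow> ('z \<Rightarrow>\<^sub>0 'a)) \<Rightarrow> (('y \<Rightarrow>\<^sub>0 'a) \<Rightarrow> ('w \<Rightarrow>\<^sub>0 'a))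
      \<Rightarrow> ('x \<times> 'y \<Rightarrow>\<^sub>0 'a) \<Rightarrow> ('z \<times> 'w \<Rightarrow>\<^sub>0 'a)" where
  "tensor_map f g = fextend (\<lambda>(x, y). tensor (f (fbasis x)) (g (fbasis y)))"

text \<open>Triples are nested to the right, so \<open>V \<otimes> V \<otimes> V\<close> is the free module on \<open>'x \<times> 'x \<times> 'x\<close>;
  \<open>f \<otimes> I\<close> has to be transported along the associativity isomorphism.\<close>

definition assoc_right :: "(('x \<times> 'y) \<times> 'z \<Rightarrow>\<^sub>0 'a::comm_ring_1) \<Rightarrow> ('x \<times> 'y \<times> 'z \<Rightarrow>\<^sub>0 'a)" where
  "assoc_right = fextend (\<lambda>((x, y), z). fbasis (x, y, z))"

definition assoc_left :: "('x \<times> 'y \<times> 'z \<Rightarrow>\<^sub>0 'a::comm_ring_1) \<Rightarrow> (('x \<times> 'y) \<times> 'z \<Rightarrow>\<^sub>0 'a)" where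
  "assoc_left = fextend (\<lambda>(x, y, z). fbasis ((x, y), z))"

definition on_first ::
    "(('x \<times> 'x \<Rightarrow>\<^sub>0 'a::comm_ring_1) \<Rightarrow> ('x \<times> 'x \<Rightarrow>\<^sub>0 'a))
      \<Rightarrow> ('x \<times> 'x \<times> 'x \<Rightarrow>\<^sub>0 'a) \<Rightarrow> ('x \<times> 'x \<times> 'x \<Rightarrow>\<^sub>0 'a)" where
  "on_first f = assoc_right \<circ> tensor_map f id \<circ> assoc_left"

definition on_last ::
    "(('x \<times> 'x \<Rightarrow>\<^sub>0 'a::comm_ring_1) \<Rightarrow> ('x \<times> 'x \<Rightarrow>\<^sub>0 'a))
      \<Rightarrow> ('x \<times> 'x \<times> 'x \<Rightarrow>\<^sub>0 'a) \<Rightarrow> ('x \<times> 'x \<times> 'x \<Rightarrow>\<^sub>0 'a)" where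
  "on_last f = tensor_map id f"


section \<open>Racks\<close>

definition rack :: "('q \<Rightarrow> 'q \<Rightarrow> 'q) \<Rightarrow> bool" where
  "rack r \<longleftrightarrow> (\<forall>y. bij (\<lambda>x. r x y)) \<and> (\<forall>x y z. r (r x y) z = r (r x z) (r y z))"

definition rack_Inn :: "('q \<Rightarrow> 'q \<Rightarrow> 'q) \<Rightarrow> ('q \<Rightarrow> 'q) set" where
  "rack_Inn r = generate (BijGroup UNIV) (range (\<lambda>y x. r x y))"

definition rack_op :: "('q \<Rightarrow> 'q \<Rightarrow> 'q) \<Rightarrow> ('q \<times> 'q \<Rightarrow>\<^sub>0 'a::comm_ring_1) \<Rightarrow> ('q \<times> 'q \<Rightarrow>\<^sub>0 'a)" where
  "rack_op r = fextend (\<lambda>(x, y). fbasis (y, r x y))"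


section \<open>Yang-Baxter operators and their deformations\<close>

definition yang_baxter :: "(('x \<times> 'x \<Rightarrow>\<^sub>0 'a::comm_ring_1) \<Rightarrow> ('x \<times> 'x \<Rightarrow>\<^sub>0 'a)) \<Rightarrow> bool" where
  "yang_baxter c \<longleftrightarrow> automorphism c \<and>
     on_first c \<circ> on_last c \<circ> on_first c = on_last c \<circ> on_first c \<circ> on_last c"

definition yb_deformation ::
    "'a::comm_ring_1 set \<Rightarrow> (('x \<times> 'x \<Rightarrow>\<^sub>0 'a) \<Rightarrow> ('x \<times> 'x \<Rightarrow>\<^sub>0 'a))
      \<Rightarrow> (('x \<times> 'x \<Rightarrow>\<^sub>0 'a) \<Rightarrow> ('x \<times> 'x \<Rightarrow>\<^sub>0 'a)) \<Rightarrow> bool" where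
  "yb_deformation m c c' \<longleftrightarrow> yang_baxter c' \<and> cong_maps m c' c"

definition yb_equivalent ::
    "'a::comm_ring_1 set \<Rightarrow> (('x \<times> 'x \<Rightarrow>\<^sub>0 'a) \<Rightarrow> ('x \<times> 'x \<Rightarrow>\<^sub>0 'a))
      \<Rightarrow> (('x \<times> 'x \<Rightarrow>\<^sub>0 'a) \<Rightarrow> ('x \<times> 'x \<Rightarrow>\<^sub>0 'a)) \<Rightarrow> bool" where
  "yb_equivalent m c c' \<longleftrightarrow> yang_baxter c \<and> yang_baxter c' \<and>
     (\<exists>\<alpha>. automorphism \<alpha> \<and> cong_maps m \<alpha> id \<and>
        c' = tensor_map \<alpha> \<alpha> \<circ> c \<circ> inv_into UNIV (tensor_map \<alpha> \<alpha>))"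

text \<open>The three equations are the cases \<open>i = 0, 1, 2\<close> of
  \<open>(c\<^sub>2 \<cdots> c\<^sub>i\<^sub>+\<^sub>1)\<^sup>-\<^sup>1 (f \<otimes> I) (c\<^sub>2 \<cdots> c\<^sub>i\<^sub>+\<^sub>1) = (c\<^sub>1 \<cdots> c\<^sub>i)\<^sup>-\<^sup>1 (I \<otimes> f) (c\<^sub>1 \<cdots> c\<^sub>i)\<close>;
  an empty product is the identity.\<close>

definition entropic ::
    "('q \<Rightarrow> 'q \<Rightarrow> 'q) \<Rightarrow> (('q \<times> 'q \<Rightarrow>\<^sub>0 'a::comm_ring_1) \<Rightarrow> ('q \<times> 'q \<Rightarrow>\<^sub>0 'a)) \<Rightarrow> bool" where
  "entropic r f \<longleftrightarrow> flinear f \<and>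
     (let c1 = on_first (rack_op r); c2 = on_last (rack_op r) in
        inv_into UNIV (c2 \<circ> c1) \<circ> on_first f \<circ> (c2 \<circ> c1) = on_last f \<and>
        inv_into UNIV c2 \<circ> on_first f \<circ> c2 = inv_into UNIV c1 \<circ> on_last f \<circ> c1 \<and>
        on_first f = inv_into UNIV (c1 \<circ> c2) \<circ> on_last f \<circ> (c1 \<circ> c2))"

definition entropic_deformation ::
    "'a::comm_ring_1 set \<Rightarrow> ('q \<Rightarrow> 'q \<Rightarrow> 'q)
      \<Rightarrow> (('q \<times> 'q \<Rightarrow>\<^sub>0 'a) \<Rightarrow> ('q \<times> 'q \<Rightarrow>\<^sub>0 'a)) \<Rightarrow> bool" where
  "entropic_deformation m r c \<longleftrightarrow>
     (\<exists>f. entropic r f \<and> cong_maps m f id \<and> c = rack_op r \<circ> f)"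


section \<open>Completeness of free modules\<close>

lemma lookup_fscale [simp]:
  "Poly_Mapping.lookup (fscale a v) x = a * Poly_Mapping.lookup v x"
  by (simp add: fscale_def Poly_Mapping.map.rep_eq when_def)

lemma module_fscale: "module (fscale :: 'a::comm_ring_1 \<Rightarrow> ('x \<Rightarrow>\<^sub>0 'a) \<Rightarrow> _)"
  by unfold_locales (auto intro!: poly_mapping_eqI simp: lookup_add algebra_simps)

lemma module_times: "module ((*) :: 'a::comm_ring_1 \<Rightarrow> 'a \<Rightarrow> 'a)"
  by unfold_locales (auto simp: algebra_simps)

lemma is_ideal_ideal_power: "is_ideal (ideal_power I n)"
  by (cases n) (auto simp: module.subspace_span[OF module_times] module.subspace_UNIV[OF module_times])

lemma ideal_mult_right: "is_ideal I \<Longrightarrow> a \<in> I \<Longrightarrow> a * b \<in> I"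
  using module.subspace_scale[OF module_times, of I a b] by (simp add: mult.commute)

lemma ideal_times_self:
  assumes "is_ideal I" shows "ideal_times (*) I = I"
proof
  show "ideal_times (*) I \<subseteq> I"
    unfolding ideal_times_def
    by (rule module.span_minimal[OF module_times _ assms])
       (auto intro: ideal_mult_right[OF assms])
  show "I \<subseteq> ideal_times (*) I"
  proof
    fix x assume "x \<in> I"
    then have "\<exists>a v. x = a * v \<and> a \<in> I" by (intro exI[of _ x] exI[of _ 1]) simp
    then have "x \<in> {a * v |a v. a \<in> I}" by simp
    then show "x \<in> ideal_times (*) I"
      unfolding ideal_times_def by (rule module.span_base[OF module_times])
  qed
qed

lemma poly_mapping_sum_basis:
  "v = (\<Sum>x\<in>Poly_Mapping.keys v. fscale (Poly_Mapping.lookup v x) (fbasis x))"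
proof (rule poly_mapping_eqI)
  fix k
  show "Poly_Mapping.lookup v k
      = Poly_Mapping.lookup (\<Sum>x\<in>Poly_Mapping.keys v. fscale (Poly_Mapping.lookup v x) (fbasis x)) k"
    by (simp add: lookup_sum fbasis_def lookup_single when_def if_distrib
        sum.delta' not_in_keys_iff_lookup_eq_zero cong: if_cong)
qed

lemma ideal_times_fscale:
  fixes I :: "'a::comm_ring_1 set"
  assumes "is_ideal I"
  shows "ideal_times fscale I = {v :: 'x \<Rightarrow>\<^sub>0 'a. \<forall>x. Poly_Mapping.lookup v x \<in> I}" (is "_ = ?R")
proof
  note sub = module.subspace_0[OF module_times assms] module.subspace_add[OF module_times assms]
    module.subspace_scale[OF module_times assms]
  have "module.subspace fscale ?R"
    by (rule module.subspaceI[OF module_fscale]) (auto simp: lookup_add intro: sub)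
  moreover have "{fscale a v |a v. a \<in> I} \<subseteq> ?R"
    by (auto intro: ideal_mult_right[OF assms])
  ultimately show "ideal_times fscale I \<subseteq> ?R"
    unfolding ideal_times_def by (simp add: module.span_minimal[OF module_fscale])
  show "?R \<subseteq> ideal_times fscale I"
  proof
    fix v :: "'x \<Rightarrow>\<^sub>0 'a" assume v: "v \<in> ?R"
    have "(\<Sum>x\<in>Poly_Mapping.keys v. fscale (Poly_Mapping.lookup v x) (fbasis x)) \<in> ideal_times fscale I"
      unfolding ideal_times_def
      by (rule module.span_sum[OF module_fscale], rule module.span_base[OF module_fscale])
         (use v in auto)
    then show "v \<in> ideal_times fscale I" using poly_mapping_sum_basis[of v] by simp
  qed
qed

lemma adic_complete_iff:
  fixes s :: "'a::comm_ring_1 \<Rightarrow> 'b::ab_group_add \<Rightarrow> 'b"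
  assumes "module s"
  shows "adic_complete s m \<longleftrightarrow>
     (\<forall>v. (\<forall>n. v \<in> ideal_times s (ideal_power m n)) \<longrightarrow> v = 0) \<and>
     (\<forall>X. (\<forall>n. X (Suc n) - X n \<in> ideal_times s (ideal_power m n)) \<longrightarrow>
          (\<exists>v. \<forall>n. v - X n \<in> ideal_times s (ideal_power m n)))"
    (is "_ \<longleftrightarrow> ?sep \<and> ?lim")
proof -
  let ?J = "\<lambda>n. ideal_times s (ideal_power m n)"
  let ?C = "\<lambda>n. cong_rel s (ideal_power m n)"
  let ?nat = "\<lambda>v n. ?C n `` {v}"
  have subJ: "module.subspace s (?J n)" for n
    by (simp add: ideal_times_def module.subspace_span[OF assms])
  note J0 = module.subspace_0[OF assms subJ] and Jadd = module.subspace_add[OF assms subJ]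
    and Jdiff = module.subspace_diff[OF assms subJ] and Jneg = module.subspace_neg[OF assms subJ]
  have powsub: "ideal_power m (Suc n) \<subseteq> ideal_power m n" for n
    unfolding ideal_power.simps
    by (rule module.span_minimal[OF module_times _ is_ideal_ideal_power])
       (auto intro: module.subspace_scale[OF module_times is_ideal_ideal_power])
  have Jsub: "?J (Suc n) \<subseteq> ?J n" for n
    unfolding ideal_times_def using powsub[of n]
    by (intro module.span_mono[OF assms]) blast
  have mem: "u \<in> ?C n `` {v} \<longleftrightarrow> u - v \<in> ?J n" for u v n
    using Jneg[of "u - v" n] Jneg[of "v - u" n] by (auto simp: cong_rel_def)
  have eqC: "?C n `` {u} = ?C n `` {v} \<longleftrightarrow> u - v \<in> ?J n" for u v n
  proof
    assume "?C n `` {u} = ?C n `` {v}"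
    moreover have "u \<in> ?C n `` {u}" by (simp only: mem diff_self J0)
    ultimately show "u - v \<in> ?J n" by (simp only: mem)
  next
    assume uv: "u - v \<in> ?J n"
    show "?C n `` {u} = ?C n `` {v}"
    proof (rule Set.set_eqI)
      fix w
      show "w \<in> ?C n `` {u} \<longleftrightarrow> w \<in> ?C n `` {v}"
        unfolding mem using Jadd[OF _ uv, of "w - u"] Jdiff[OF _ uv, of "w - v"]
        by (auto simp: algebra_simps)
    qed
  qed
  have nat_in: "?nat v \<in> adic_limit s m" for v
    unfolding adic_limit_def
  proof (intro CollectI conjI allI subsetI)
    fix n show "?nat v n \<in> UNIV // ?C n" by (auto simp: quotient_def)
    fix w assume "w \<in> ?nat v (Suc n)"
    then show "w \<in> ?nat v n" using mem Jsub by blast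
  qed
  have inj: "inj ?nat \<longleftrightarrow> ?sep"
  proof
    assume i: "inj ?nat"
    show ?sep
    proof (intro allI impI)
      fix v assume "\<forall>n. v \<in> ?J n"
      then have "?nat v n = ?nat 0 n" for n using eqC[of n v 0] by simp
      then have "?nat v = ?nat 0" by (rule ext)
      with i show "v = 0" by (auto dest: injD)
    qed
  next
    assume sep: ?sep
    show "inj ?nat"
    proof (rule injI)
      fix u v assume "?nat u = ?nat v"
      then have "?nat u n = ?nat v n" for n by (rule fun_cong)
      then have "\<forall>n. u - v \<in> ?J n" using eqC by blast
      with sep have "u - v = 0" by blast
      then show "u = v" by simp
    qed
  qed
  have surj: "?nat ` UNIV = adic_limit s m \<longleftrightarrow> ?lim"
  proof
    assume s: "?nat ` UNIV = adic_limit s m"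
    show ?lim
    proof (intro allI impI)
      fix X assume X: "\<forall>n. X (Suc n) - X n \<in> ?J n"
      have "(\<lambda>n. ?C n `` {X n}) \<in> adic_limit s m"
        unfolding adic_limit_def
      proof (intro CollectI conjI allI subsetI)
        fix n show "?C n `` {X n} \<in> UNIV // ?C n" by (auto simp: quotient_def)
        fix w assume "w \<in> ?C (Suc n) `` {X (Suc n)}"
        then have "w - X (Suc n) \<in> ?J n" using mem Jsub by blast
        from Jadd[OF this X[rule_format, of n]] show "w \<in> ?C n `` {X n}"
          unfolding mem by simp
      qed
      with s obtain v where v: "(\<lambda>n. ?C n `` {X n}) = ?nat v" by blast
      have "v - X n \<in> ?J n" for n
        using fun_cong[OF v, of n] eqC[of n v "X n"] by simp
      then show "\<exists>v. \<forall>n. v - X n \<in> ?J n" by blast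
    qed
  next
    assume l: ?lim
    have "F \<in> ?nat ` UNIV" if F: "F \<in> adic_limit s m" for F
    proof -
      have "\<exists>x. F n = ?C n `` {x}" for n
        using F by (auto simp: adic_limit_def quotient_def)
      then obtain X where X: "\<And>n. F n = ?C n `` {X n}" by metis
      have "X (Suc n) \<in> F n" for n
      proof -
        have "X (Suc n) \<in> F (Suc n)" unfolding X mem by (simp only: diff_self J0)
        then show ?thesis using F by (auto simp: adic_limit_def)
      qed
      then have "\<forall>n. X (Suc n) - X n \<in> ?J n" unfolding X mem by blast
      with l obtain v where v: "\<forall>n. v - X n \<in> ?J n" by blast
      have "F n = ?nat v n" for n
        unfolding X eqC using Jneg[OF v[rule_format, of n]] by simp
      then have "F = ?nat v" by (rule ext)
      then show ?thesis by blast
    qed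
    with nat_in show "?nat ` UNIV = adic_limit s m" by blast
  qed
  show ?thesis unfolding adic_complete_def bij_betw_def using inj surj by blast
qed

text \<open>For a finite basis, completeness of the ring already gives completeness of the free
  module; for an infinite basis it does so when the ideal is nilpotent. In general a free module of
  infinite rank over a complete ring is not complete, and limits of automorphisms such as
  \<open>\<Prod>n. (I + g\<^sub>n)\<close> with \<open>g\<^sub>n \<equiv> 0\<close> modulo \<open>m\<^sup>n\<close> need not exist on it.\<close>

lemma adic_complete_free_finite:
  fixes m :: "'a::comm_ring_1 set"
  assumes "finite (UNIV :: 'x set)" and compl: "adic_complete (*) m"
  shows "adic_complete (fscale :: 'a \<Rightarrow> ('x \<Rightarrow>\<^sub>0 'a) \<Rightarrow> _) m"
  unfolding adic_complete_iff[OF module_fscale] ideal_times_fscale[OF is_ideal_ideal_power]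
proof (intro conjI allI impI)
  note A = compl[unfolded adic_complete_iff[OF module_times] ideal_times_self[OF is_ideal_ideal_power]]
  fix v :: "'x \<Rightarrow>\<^sub>0 'a"
  assume "\<forall>n. v \<in> {v. \<forall>x. Poly_Mapping.lookup v x \<in> ideal_power m n}"
  then show "v = 0" using A by (intro poly_mapping_eqI) simp
next
  note A = compl[unfolded adic_complete_iff[OF module_times] ideal_times_self[OF is_ideal_ideal_power]]
  fix X :: "nat \<Rightarrow> 'x \<Rightarrow>\<^sub>0 'a"
  assume "\<forall>n. X (Suc n) - X n \<in> {v. \<forall>x. Poly_Mapping.lookup v x \<in> ideal_power m n}"
  then have "\<exists>a. \<forall>n. a - Poly_Mapping.lookup (X n) x \<in> ideal_power m n" for x
    by (intro A[THEN conjunct2, rule_format]) (simp add: lookup_minus)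
  then obtain g where g: "\<And>x n. g x - Poly_Mapping.lookup (X n) x \<in> ideal_power m n" by metis
  have "Poly_Mapping.lookup (Abs_poly_mapping g) = g"
    by (rule lookup_Abs_poly_mapping) (rule finite_subset[OF subset_UNIV assms(1)])
  with g have "\<forall>n. Abs_poly_mapping g - X n \<in> {v. \<forall>x. Poly_Mapping.lookup v x \<in> ideal_power m n}"
    by (simp add: lookup_minus)
  then show "\<exists>v. \<forall>n. v - X n \<in> {v. \<forall>x. Poly_Mapping.lookup v x \<in> ideal_power m n}" by blast
qed

lemma adic_complete_free_nilpotent:
  fixes m :: "'a::comm_ring_1 set"
  assumes nil: "ideal_power m N = {0}"
  shows "adic_complete (fscale :: 'a \<Rightarrow> ('x \<Rightarrow>\<^sub>0 'a) \<Rightarrow> _) m"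
  unfolding adic_complete_iff[OF module_fscale] ideal_times_fscale[OF is_ideal_ideal_power]
proof (intro conjI allI impI)
  fix v :: "'x \<Rightarrow>\<^sub>0 'a"
  assume "\<forall>n. v \<in> {v. \<forall>x. Poly_Mapping.lookup v x \<in> ideal_power m n}"
  then have "\<forall>x. Poly_Mapping.lookup v x \<in> ideal_power m N" by blast
  then show "v = 0" using nil by (intro poly_mapping_eqI) simp
next
  let ?J = "\<lambda>n. {v :: 'x \<Rightarrow>\<^sub>0 'a. \<forall>x. Poly_Mapping.lookup v x \<in> ideal_power m n}"
  note sub = module.subspace_0[OF module_times is_ideal_ideal_power]
    module.subspace_add[OF module_times is_ideal_ideal_power]
    module.subspace_neg[OF module_times is_ideal_ideal_power]
  have powsub: "ideal_power m (Suc n) \<subseteq> ideal_power m n" for n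
    unfolding ideal_power.simps
    by (rule module.span_minimal[OF module_times _ is_ideal_ideal_power])
       (auto intro: module.subspace_scale[OF module_times is_ideal_ideal_power])
  have antimono: "ideal_power m k \<subseteq> ideal_power m n" if "n \<le> k" for n k
    using lift_Suc_antimono_le[of "ideal_power m"] powsub that by blast
  fix X :: "nat \<Rightarrow> 'x \<Rightarrow>\<^sub>0 'a"
  assume X: "\<forall>n. X (Suc n) - X n \<in> ?J n"
  have step: "X (n + k) - X n \<in> ?J n" for n k
  proof (induction k)
    case 0
    show ?case by (simp add: sub)
  next
    case (Suc k)
    have "X (Suc (n + k)) - X (n + k) \<in> ?J n" using X antimono[of n "n + k"] by fastforce
    with Suc have "(X (Suc (n + k)) - X (n + k)) + (X (n + k) - X n) \<in> ?J n"
      by (simp only: mem_Collect_eq lookup_add) (metis sub(2))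
    then show ?case by simp
  qed
  have "X N - X n \<in> ?J n" for n
  proof (cases "n \<le> N")
    case True
    then show ?thesis using step[of n "N - n"] by simp
  next
    case False
    then have "X n - X N \<in> ?J N" using step[of N "n - N"] by simp
    then have "X n - X N = 0" using nil by (intro poly_mapping_eqI) simp
    then have "X n = X N" by simp
    then show ?thesis by (simp add: sub)
  qed
  then show "\<exists>v. \<forall>n. v - X n \<in> ?J n" by blast
qed

end

theory Submission
  imports Defs
begin

text \<open>
The theorem is a deformation argument: a Yang-Baxter deformation \<open>c\<close> is corrected modulo one power of
\<open>m\<close> after the other, and the corrections are multiplied together in the limit. Completeness of the
module makes the limit exist and makes every map \<open>I + g\<close> with \<open>g \<equiv> 0\<close> modulo \<open>m\<close> invertible
(\<open>endo_limit\<close>, \<open>neumann_inverse\<close>); completeness of the ring makes an operator entropic as soon as it is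
so modulo every power (\<open>entropic_limit\<close>).

Throughout, a linear map is handled through its matrix. Call two elements of the rack alike if they
act in the same way by right translation. A map \<open>f\<close> on two strands is entropic if its matrix is
supported on pairs with \<open>x\<^sub>0\<close> alike \<open>y\<^sub>0\<close> and \<open>x\<^sub>1\<close> alike \<open>y\<^sub>1\<close>, and is invariant when inner automorphisms act on
the two strands independently of each other (\<open>entropic_kernel\<close>, \<open>entropic_of_entropic_endo\<close>).

Suppose that \<open>c = c\<^sub>Q (f + e)\<close> with \<open>f\<close> entropic and \<open>e\<close> in \<open>m\<^sup>n\<close>. Because \<open>f\<close> slides along braids, the
Yang-Baxter equation says modulo \<open>m\<^sup>n\<^sup>+\<^sup>1\<close> that \<open>N + d e = 0\<close>, where \<open>N\<close> is the commutator-like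
expression \<open>f\<^sub>2 f\<^sub>1\<^sub>3 f\<^sub>1 - f\<^sub>1 f\<^sub>1\<^sub>3 f\<^sub>2\<close> and \<open>d e\<close> is the Yang-Baxter differential of \<open>e\<close> (\<open>braid_first_order\<close>).
Now \<open>N\<close> is entropic on three strands, hence equal to its own average over the inner
automorphisms of each strand; but the average of \<open>d e\<close> over quasi-diagonal entries is zero. Since the
order of the inner automorphism group is invertible, \<open>N\<close> and \<open>d e\<close> vanish separately modulo \<open>m\<^sup>n\<^sup>+\<^sup>1\<close>
(\<open>entropic_obstruction_vanishes\<close>, \<open>differential_small\<close>).

So \<open>e\<close> is a cocycle modulo \<open>m\<^sup>n\<^sup>+\<^sup>1\<close>, and it remains to write it as an entropic \<open>h\<close> minus a coboundary \<open>d g\<close>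
with \<open>g\<close> and \<open>h\<close> in \<open>m\<^sup>n\<close> (\<open>cohomologous_to_entropic\<close>). Inner automorphisms act trivially on cohomology,
because fixing the last strand of a cocycle provides a homotopy (\<open>inner_homotopy\<close>); hence \<open>e\<close> may be
averaged. For the averaged cocycle the entries at alike second coordinates are already entropic,
and the entries at unlike second coordinates form a coboundary that can be read off directly
(\<open>avg_separated\<close>). Conjugating \<open>c\<close> by \<open>I + g\<close> then replaces \<open>f\<close> by \<open>f + h\<close> and pushes the error into
\<open>m\<^sup>n\<^sup>+\<^sup>1\<close> (\<open>entropic_improvement\<close>).
\<close>

section \<open>Linear maps between free modules\<close>


lemma lookup_fbasis: "Poly_Mapping.lookup (fbasis x :: 'x \<Rightarrow>\<^sub>0 'a::comm_ring_1) y = of_bool (x = y)"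
  by (simp add: fbasis_def lookup_single when_def)

lemma flinearI:
  fixes f :: "('x \<Rightarrow>\<^sub>0 'a::comm_ring_1) \<Rightarrow> ('y \<Rightarrow>\<^sub>0 'a)"
  assumes "\<And>u v. f (u + v) = f u + f v" "\<And>a v. f (fscale a v) = fscale a (f v)"
  shows "flinear f"
  by (rule module_hom.intro[OF module_fscale module_fscale], unfold_locales) (use assms in auto)

lemmas flinear_add = module_hom.add
lemmas flinear_scale = module_hom.scale
lemmas flinear_sum = module_hom.sum

lemma lookup_flinear:
  fixes f :: "('x \<Rightarrow>\<^sub>0 'a::comm_ring_1) \<Rightarrow> ('y \<Rightarrow>\<^sub>0 'a)"
  assumes "flinear f"
  shows "Poly_Mapping.lookup (f v) y = (\<Sum>x\<in>Poly_Mapping.keys v. Poly_Mapping.lookup v x * Poly_Mapping.lookup (f (fbasis x)) y)"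
proof -
  have "f v = f (\<Sum>x\<in>Poly_Mapping.keys v. fscale (Poly_Mapping.lookup v x) (fbasis x))"
    using poly_mapping_sum_basis[of v] by simp
  also have "\<dots> = (\<Sum>x\<in>Poly_Mapping.keys v. fscale (Poly_Mapping.lookup v x) (f (fbasis x)))"
    by (simp add: flinear_sum[OF assms] flinear_scale[OF assms])
  finally show ?thesis by (simp add: lookup_sum)
qed

lemma flinear_eqI:
  fixes f g :: "('x \<Rightarrow>\<^sub>0 'a::comm_ring_1) \<Rightarrow> ('y \<Rightarrow>\<^sub>0 'a)"
  assumes "flinear f" "flinear g" "\<And>x. f (fbasis x) = g (fbasis x)"
  shows "f = g"
  by (rule ext, rule poly_mapping_eqI, subst lookup_flinear[OF assms(1)], subst lookup_flinear[OF assms(2)])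
     (simp add: assms(3))

lemma lookup_fextend:
  assumes "finite S" "Poly_Mapping.keys v \<subseteq> S"
  shows "Poly_Mapping.lookup (fextend \<phi> v) y = (\<Sum>x\<in>S. Poly_Mapping.lookup v x * Poly_Mapping.lookup (\<phi> x) y)"
proof -
  have "Poly_Mapping.lookup (fextend \<phi> v) y = (\<Sum>x\<in>Poly_Mapping.keys v. Poly_Mapping.lookup v x * Poly_Mapping.lookup (\<phi> x) y)"
    by (simp add: fextend_def lookup_sum)
  also have "\<dots> = (\<Sum>x\<in>S. Poly_Mapping.lookup v x * Poly_Mapping.lookup (\<phi> x) y)"
    by (rule sum.mono_neutral_left) (use assms in \<open>auto simp: not_in_keys_iff_lookup_eq_zero\<close>)
  finally show ?thesis .
qed

lemma flinear_fextend [simp]: "flinear (fextend \<phi> :: ('x \<Rightarrow>\<^sub>0 'a::comm_ring_1) \<Rightarrow> ('y \<Rightarrow>\<^sub>0 'a))"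
proof (rule flinearI; rule poly_mapping_eqI)
  fix u v :: "'x \<Rightarrow>\<^sub>0 'a" and y :: 'y
  let ?S = "Poly_Mapping.keys u \<union> Poly_Mapping.keys v"
  have "finite ?S" "Poly_Mapping.keys (u + v) \<subseteq> ?S"
    using Poly_Mapping.keys_add[of u v] by auto
  then show "Poly_Mapping.lookup (fextend \<phi> (u + v)) y = Poly_Mapping.lookup (fextend \<phi> u + fextend \<phi> v) y"
    by (simp add: lookup_fextend[of ?S] lookup_add sum.distrib algebra_simps)
next
  fix a and v :: "'x \<Rightarrow>\<^sub>0 'a" and y :: 'y
  have "Poly_Mapping.keys (fscale a v) \<subseteq> Poly_Mapping.keys v"
    by (auto simp: in_keys_iff)
  then show "Poly_Mapping.lookup (fextend \<phi> (fscale a v)) y = Poly_Mapping.lookup (fscale a (fextend \<phi> v)) y"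
    by (simp add: lookup_fextend[of "Poly_Mapping.keys v"] sum_distrib_left algebra_simps)
qed

lemma fextend_fbasis [simp]: "fextend \<phi> (fbasis x :: 'x \<Rightarrow>\<^sub>0 'a::comm_ring_1) = \<phi> x"
proof (rule poly_mapping_eqI)
  fix y
  have "Poly_Mapping.keys (fbasis x :: 'x \<Rightarrow>\<^sub>0 'a) \<subseteq> {x}" by (simp add: fbasis_def)
  then show "Poly_Mapping.lookup (fextend \<phi> (fbasis x)) y = Poly_Mapping.lookup (\<phi> x) y"
    by (simp add: lookup_fextend[of "{x}"] lookup_fbasis)
qed

lemma lookup_tensor [simp]: "Poly_Mapping.lookup (tensor u v) (x, y) = Poly_Mapping.lookup u x * Poly_Mapping.lookup v y"
proof -
  have "Poly_Mapping.lookup (tensor u v) (x, y)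
      = (\<Sum>x'\<in>Poly_Mapping.keys u. if x' = x then Poly_Mapping.lookup u x else 0)
        * (\<Sum>y'\<in>Poly_Mapping.keys v. if y' = y then Poly_Mapping.lookup v y else 0)"
    unfolding tensor_def lookup_sum sum_product
    by (intro sum.cong refl) (auto simp: lookup_single when_def)
  also have "\<dots> = Poly_Mapping.lookup u x * Poly_Mapping.lookup v y"
    by (simp add: in_keys_iff)
  finally show ?thesis .
qed

lemma flinear_tensor_map [simp]: "flinear (tensor_map f g)"
  unfolding tensor_map_def by simp

lemma tensor_map_fbasis [simp]:
  "tensor_map f g (fbasis (x, y)) = tensor (f (fbasis x)) (g (fbasis y))"
  unfolding tensor_map_def by simp

lemma flinear_comp: "flinear f \<Longrightarrow> flinear g \<Longrightarrow> flinear (g \<circ> f)"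
  by (rule flinearI) (simp_all add: flinear_add flinear_scale)

lemma flinear_id [simp]: "flinear id" "flinear (\<lambda>x. x)"
  by (auto intro: flinearI)


section \<open>The ring of endomorphisms of a free module\<close>

text \<open>Endomorphisms get a type of their own so that composition becomes the multiplication of a
noncommutative ring and the calculations below can be left to ring normalisation.\<close>

typedef (overloaded) ('x, 'a::comm_ring_1) endo =
    "{f :: ('x \<Rightarrow>\<^sub>0 'a) \<Rightarrow> ('x \<Rightarrow>\<^sub>0 'a). flinear f}"
  morphisms app endo
  by (auto intro: flinear_id)

setup_lifting type_definition_endo

lemma flinear_app [simp]: "flinear (app f)"
  using app by auto

definition coef :: "('x, 'a::comm_ring_1) endo \<Rightarrow> 'x \<Rightarrow> 'x \<Rightarrow> 'a" where
  "coef f x y = Poly_Mapping.lookup (app f (fbasis x)) y"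

lemma endo_eqI: "(\<And>x y. coef f x y = coef g x y) \<Longrightarrow> f = g"
  unfolding coef_def by (metis app_inject flinear_app flinear_eqI poly_mapping_eqI)

lemma finite_coef: "finite {y. coef f x y \<noteq> 0}"
  unfolding coef_def by simp

instantiation endo :: (type, comm_ring_1) ring_1
begin

lift_definition zero_endo :: "('a, 'b) endo" is "\<lambda>_. 0" by (rule flinearI) (auto intro: poly_mapping_eqI)
lift_definition one_endo :: "('a, 'b) endo" is id by simp
lift_definition plus_endo :: "('a, 'b) endo \<Rightarrow> ('a, 'b) endo \<Rightarrow> ('a, 'b) endo" is "\<lambda>f g v. f v + g v"
  by (rule flinearI) (auto intro!: poly_mapping_eqI simp: flinear_add flinear_scale lookup_add algebra_simps)
lift_definition uminus_endo :: "('a, 'b) endo \<Rightarrow> ('a, 'b) endo" is "\<lambda>f v. - f v"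
  by (rule flinearI) (auto intro!: poly_mapping_eqI simp: flinear_add flinear_scale)
lift_definition minus_endo :: "('a, 'b) endo \<Rightarrow> ('a, 'b) endo \<Rightarrow> ('a, 'b) endo" is "\<lambda>f g v. f v - g v"
  by (rule flinearI)
     (simp add: flinear_add,
      simp add: flinear_scale poly_mapping_eq_iff fun_eq_iff lookup_minus right_diff_distrib)
lift_definition times_endo :: "('a, 'b) endo \<Rightarrow> ('a, 'b) endo \<Rightarrow> ('a, 'b) endo" is "(\<circ>)"
  by (rule flinear_comp)

instance
proof
  show "(0 :: ('a, 'b) endo) \<noteq> 1"
  proof
    assume "(0 :: ('a, 'b) endo) = 1"
    then have "0 = (fbasis x :: 'a \<Rightarrow>\<^sub>0 'b)" for x
      by (metis zero_endo.rep_eq one_endo.rep_eq id_apply)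
    then show False by (metis lookup_fbasis lookup_zero of_bool_eq(2) zero_neq_one)
  qed
qed (transfer; simp add: fun_eq_iff flinear_add)+

end

lemma app_simps:
  "app 0 v = 0" "app 1 v = v" "app (f + g) v = app f v + app g v" "app (f - g) v = app f v - app g v"
  "app (f * g) v = app f (app g v)"
  by (transfer; simp)+

lemma coef_simps:
  "coef 0 x y = 0" "coef 1 x y = of_bool (x = y)" "coef (f + g) x y = coef f x y + coef g x y"
  "coef (f - g) x y = coef f x y - coef g x y"
  by (simp_all add: coef_def app_simps lookup_fbasis lookup_add lookup_minus)

lemma coef_mult: "coef (g * f) x y = (\<Sum>z\<in>{z. coef f x z \<noteq> 0}. coef f x z * coef g z y)"
  unfolding coef_def app_simps lookup_flinear[OF flinear_app, of g "app f (fbasis x)"]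
  by (simp add: keys.rep_eq)

text \<open>Only row-finite kernels define an endomorphism; for others the value is arbitrary.\<close>

definition of_kernel :: "('x \<Rightarrow> 'x \<Rightarrow> 'a::comm_ring_1) \<Rightarrow> ('x, 'a) endo" where
  "of_kernel k = endo (fextend (\<lambda>x. Abs_poly_mapping (k x)))"

lemma coef_of_kernel:
  assumes "\<And>x. finite {y. k x y \<noteq> 0}"
  shows "coef (of_kernel k) x y = k x y"
  unfolding coef_def of_kernel_def using assms
  by (simp add: endo_inverse)

definition perm :: "('x \<Rightarrow> 'x) \<Rightarrow> ('x, 'a::comm_ring_1) endo" where
  "perm \<sigma> = endo (fextend (\<lambda>x. fbasis (\<sigma> x)))"

lemma app_perm [simp]: "app (perm \<sigma>) (fbasis x) = fbasis (\<sigma> x)"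
  unfolding perm_def by (simp add: endo_inverse)

lemma coef_perm: "coef (perm \<sigma>) x y = of_bool (\<sigma> x = y)"
  by (simp add: coef_def lookup_fbasis)

lemma coef_mult_perm [simp]: "coef (f * perm \<sigma>) x y = coef f (\<sigma> x) y"
  by (simp add: coef_def app_simps)

lemma coef_perm_mult:
  fixes f :: "('x, 'a::comm_ring_1) endo"
  assumes "inj \<sigma>" shows "coef (perm \<sigma> * f) x (\<sigma> y) = coef f x y"
proof -
  have "coef (perm \<sigma> * f) x (\<sigma> y) = (\<Sum>z\<in>{z. coef f x z \<noteq> 0}. if z = y then coef f x y else 0)"
    unfolding coef_mult coef_perm by (intro sum.cong) (auto simp: inj_eq[OF assms])
  also have "\<dots> = coef f x y" by (simp add: finite_coef)
  finally show ?thesis .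
qed

lemma perm_comp: "perm \<sigma> * perm \<tau> = perm (\<sigma> \<circ> \<tau>)"
  by (rule endo_eqI) (simp add: coef_perm)

lemma perm_id: "perm id = 1"
  by (rule endo_eqI) (simp add: coef_perm coef_simps)

text \<open>The main device for passing from matrix entries to identities between operators: conjugation by a
permutation of the basis permutes the entries.\<close>

lemma perm_intertwines:
  fixes f g :: "('x, 'a::comm_ring_1) endo"
  assumes "bij \<sigma>" "\<And>x y. coef f (\<sigma> x) (\<sigma> y) = coef g x y"
  shows "f * perm \<sigma> = perm \<sigma> * g"
proof (rule endo_eqI)
  fix x y
  obtain y' where y: "y = \<sigma> y'" using assms(1) by (metis bij_pointE)
  show "coef (f * perm \<sigma>) x y = coef (perm \<sigma> * g) x y"
    unfolding y by (simp add: assms bij_is_inj coef_perm_mult)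
qed

section \<open>Tensor products of endomorphisms\<close>

lift_definition tens :: "('x, 'a::comm_ring_1) endo \<Rightarrow> ('y, 'a) endo \<Rightarrow> ('x \<times> 'y, 'a) endo"
  is tensor_map by simp

lemma coef_tens: "coef (tens f g) (x, y) (x', y') = coef f x x' * coef g y y'"
  unfolding coef_def by (transfer) simp

lemma tens_one: "tens 1 1 = (1 :: ('x \<times> 'y, 'a::comm_ring_1) endo)"
  by (rule endo_eqI) (clarsimp simp: coef_tens coef_simps of_bool_conj)

lemma tens_add_left: "tens (f + f') g = tens f g + tens f' g"
  and tens_add_right: "tens f (g + g') = tens f g + tens f g'"
  by (rule endo_eqI; clarsimp simp: coef_tens coef_simps algebra_simps)+

lemma tens_mult: "tens f g * tens f' g' = tens (f * f') (g * g')"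
proof (rule endo_eqI; clarify)
  fix x y x' y'
  let ?A = "{z. coef f' x z \<noteq> 0}" and ?B = "{z. coef g' y z \<noteq> 0}"
  have "coef (tens f g * tens f' g') (x, y) (x', y')
      = (\<Sum>z\<in>?A \<times> ?B. coef (tens f' g') (x, y) z * coef (tens f g) z (x', y'))"
    unfolding coef_mult by (rule sum.mono_neutral_left) (auto simp: coef_tens finite_coef)
  also have "\<dots> = (\<Sum>z\<in>?A. \<Sum>w\<in>?B. (coef f' x z * coef f z x') * (coef g' y w * coef g w y'))"
    unfolding sum.cartesian_product by (intro sum.cong refl) (auto simp: coef_tens algebra_simps)
  also have "\<dots> = coef (tens (f * f') (g * g')) (x, y) (x', y')"
    by (simp add: coef_tens coef_mult sum_product)
  finally show "coef (tens f g * tens f' g') (x, y) (x', y') = coef (tens (f * f') (g * g')) (x, y) (x', y')" .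
qed

lift_definition reassoc :: "(('x \<times> 'y) \<times> 'z, 'a::comm_ring_1) endo \<Rightarrow> ('x \<times> 'y \<times> 'z, 'a) endo"
  is "\<lambda>f. assoc_right \<circ> f \<circ> assoc_left"
  unfolding assoc_right_def assoc_left_def by (intro flinear_comp) auto

lemma assoc_left_right: "assoc_left \<circ> assoc_right = id"
  by (rule flinear_eqI) (auto simp: assoc_left_def assoc_right_def intro: flinear_comp)

lemma lookup_assoc_right: "Poly_Mapping.lookup (assoc_right v) (x, y, z) = Poly_Mapping.lookup v ((x, y), z)"
proof -
  have "Poly_Mapping.lookup (assoc_right v) (x, y, z) = (\<Sum>w\<in>Poly_Mapping.keys v. if w = ((x, y), z) then Poly_Mapping.lookup v w else 0)"
    unfolding assoc_right_def
    by (subst lookup_fextend[OF _ order_refl], simp, intro sum.cong refl)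
       (auto simp: lookup_fbasis of_bool_def split: if_splits)
  also have "\<dots> = Poly_Mapping.lookup v ((x, y), z)" by (simp add: in_keys_iff)
  finally show ?thesis .
qed

lemma coef_reassoc: "coef (reassoc f) (x, y, z) (x', y', z') = coef f ((x, y), z) ((x', y'), z')"
  unfolding coef_def by transfer (simp add: lookup_assoc_right, simp add: assoc_left_def)

lemma reassoc_mult: "reassoc (f * g) = reassoc f * reassoc g"
  by transfer (simp add: fun_eq_iff pointfree_idE[OF assoc_left_right])

lemma reassoc_add: "reassoc (f + g) = reassoc f + reassoc g"
  by (rule endo_eqI) (clarsimp simp: coef_reassoc coef_simps)

lemma reassoc_one: "reassoc 1 = 1"
  by (rule endo_eqI) (clarsimp simp: coef_reassoc coef_simps)

definition first :: "('x \<times> 'x, 'a::comm_ring_1) endo \<Rightarrow> ('x \<times> 'x \<times> 'x, 'a) endo" where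
  "first f = reassoc (tens f 1)"

definition final :: "('x \<times> 'x, 'a::comm_ring_1) endo \<Rightarrow> ('x \<times> 'x \<times> 'x, 'a) endo" where
  "final f = tens 1 f"

lemma app_first: "app (first f) = on_first (app f)"
  unfolding first_def on_first_def by transfer (rule refl)

lemma app_final: "app (final f) = on_last (app f)"
  unfolding final_def on_last_def by transfer (rule refl)

lemma coef_first: "coef (first f) (x0, x1, x2) (y0, y1, y2) = coef f (x0, x1) (y0, y1) * of_bool (x2 = y2)"
  by (simp add: first_def coef_reassoc coef_tens coef_simps)

lemma coef_final: "coef (final f) (x0, x1, x2) (y0, y1, y2) = of_bool (x0 = y0) * coef f (x1, x2) (y1, y2)"
  by (simp add: final_def coef_tens coef_simps)

lemma first_mult: "first (f * g) = first f * first g"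
  by (simp add: first_def tens_mult flip: reassoc_mult)

lemma final_mult: "final (f * g) = final f * final g"
  by (simp add: final_def tens_mult)

lemma first_add: "first (f + g) = first f + first g"
  by (simp add: first_def tens_add_left reassoc_add)

lemma final_add: "final (f + g) = final f + final g"
  by (simp add: final_def tens_add_right)

text \<open>An intertwiner of the form \<open>b \<otimes> b\<close> extends to three strands, so that the Yang-Baxter equation is
inherited by conjugates.\<close>

lemma tensor_cube_intertwines:
  assumes "f' * tens b b = tens b b * f"
  shows "first f' * tens b (tens b b) = tens b (tens b b) * first f"
    and "final f' * tens b (tens b b) = tens b (tens b b) * final f"
proof -
  have "tens b (tens b b) = reassoc (tens (tens b b) b)"
    by (rule endo_eqI) (clarsimp simp: coef_reassoc coef_tens algebra_simps)
  then show "first f' * tens b (tens b b) = tens b (tens b b) * first f"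
    by (simp add: first_def tens_mult assms flip: reassoc_mult)
  show "final f' * tens b (tens b b) = tens b (tens b b) * final f"
    by (simp add: final_def tens_mult assms)
qed

section \<open>Inner automorphisms of a rack\<close>

definition acts_alike :: "('q \<Rightarrow> 'q \<Rightarrow> 'q) \<Rightarrow> 'q \<Rightarrow> 'q \<Rightarrow> bool" where
  "acts_alike r x y \<longleftrightarrow> (\<forall>z. r z x = r z y)"

locale finite_inner_rack =
  fixes r :: "'q \<Rightarrow> 'q \<Rightarrow> 'q" and \<nu> :: "'a::comm_ring_1"
  assumes rack: "rack r" and finite_Inn: "finite (rack_Inn r)"
    and card_Inn_unit: "of_nat (card (rack_Inn r)) * \<nu> = 1"
begin

abbreviation "G \<equiv> rack_Inn r"
abbreviation "alike \<equiv> acts_alike r"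

lemma bij_translation: "bij (\<lambda>x. r x y)"
  using rack by (simp add: rack_def)

lemma self_distributive: "r (r x y) z = r (r x z) (r y z)"
  using rack by (simp add: rack_def)

lemma translation_cancel [simp]: "r x z = r y z \<longleftrightarrow> x = y"
  using bij_translation[of z] by (auto simp: bij_def inj_def)

lemma translation_surj: "\<exists>x. u = r x z"
  using bij_translation[of z] by (metis bij_pointE)

lemma translation_inverse: "r (inv_into UNIV (\<lambda>x. r x z) u) z = u"
  using surj_f_inv_f[of "\<lambda>x. r x z" u] bij_translation[of z] by (simp add: bij_is_surj)

lemma BijGroup_UNIV:
  "bij a \<Longrightarrow> bij b \<Longrightarrow> a \<otimes>\<^bsub>BijGroup UNIV\<^esub> b = a \<circ> b"
  "\<one>\<^bsub>BijGroup UNIV\<^esub> = id"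
  by (auto simp: BijGroup_def Bij_def compose_def fun_eq_iff)

lemma inv_BijGroup_UNIV: "bij a \<Longrightarrow> inv\<^bsub>BijGroup UNIV\<^esub> a = inv_into UNIV a"
  by (simp add: inv_BijGroup Bij_def restrict_def)

lemma Inn_induct_aux:
  assumes "w \<in> G" and "P id" and "\<And>y. P (\<lambda>x. r x y)" and "\<And>y. P (inv_into UNIV (\<lambda>x. r x y))"
    and "\<And>a b. a \<in> G \<Longrightarrow> b \<in> G \<Longrightarrow> bij a \<Longrightarrow> bij b \<Longrightarrow> P a \<Longrightarrow> P b \<Longrightarrow> P (a \<circ> b)"
  shows "bij w \<and> P w"
  using assms(1) unfolding rack_Inn_def
proof (induction rule: generate.induct)
  case one
  show ?case using assms(2) by (metis BijGroup_UNIV(2) bij_id)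
next
  case (incl h)
  then show ?case using bij_translation assms(3) by auto
next
  case (inv h)
  then show ?case using bij_translation assms(4) by (auto simp: inv_BijGroup_UNIV bij_imp_bij_inv)
next
  case (eng a b)
  then show ?case using assms(5)[of a b] by (metis BijGroup_UNIV(1) bij_comp rack_Inn_def)
qed

lemmas Inn_induct [consumes 1, case_names id translation inverse comp] = conjunct2[OF Inn_induct_aux]

lemma Inn_bij: "w \<in> G \<Longrightarrow> bij w"
  using Inn_induct_aux[of w "\<lambda>_. True"] by simp

lemma Inn_id: "id \<in> G"
  unfolding rack_Inn_def using generate.one[of "BijGroup UNIV"] by (simp add: BijGroup_UNIV)

lemma Inn_translation: "(\<lambda>x. r x y) \<in> G"
  unfolding rack_Inn_def by (rule generate.incl) auto

lemma Inn_comp: "a \<in> G \<Longrightarrow> b \<in> G \<Longrightarrow> a \<circ> b \<in> G"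
  using generate.eng[of a "BijGroup UNIV" "range (\<lambda>y x. r x y)" b] Inn_bij
  by (simp add: BijGroup_UNIV rack_Inn_def)

lemma Inn_inv: "w \<in> G \<Longrightarrow> inv_into UNIV w \<in> G"
proof (induction rule: Inn_induct)
  case id
  show ?case using Inn_id by (simp add: id_def)
next
  case (translation y)
  have "inv\<^bsub>BijGroup UNIV\<^esub> (\<lambda>x. r x y) \<in> G" unfolding rack_Inn_def by (rule generate.inv) auto
  then show ?case by (simp add: inv_BijGroup_UNIV bij_translation)
next
  case (inverse y)
  show ?case by (simp add: inv_inv_eq bij_translation Inn_translation)
next
  case (comp a b)
  then show ?case by (metis o_inv_distrib Inn_comp)
qed

lemma Inn_automorphism: "w \<in> G \<Longrightarrow> w (r x y) = r (w x) (w y)"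
proof (induction arbitrary: x y rule: Inn_induct)
  case (inverse z)
  show ?case
    by (subst translation_cancel[of _ z, symmetric])
       (simp only: translation_inverse
          self_distributive[of "inv_into UNIV (\<lambda>x. r x z) x" "inv_into UNIV (\<lambda>x. r x z) y" z])
next
  case (translation z)
  show ?case by (rule self_distributive)
qed simp_all

lemma Inn_eq_iff [simp]: "w \<in> G \<Longrightarrow> w x = w y \<longleftrightarrow> x = y"
  using Inn_bij by (auto simp: bij_def inj_def)

lemma alike_Inn [simp]: "w \<in> G \<Longrightarrow> alike (w x) (w y) \<longleftrightarrow> alike x y"
proof -
  have *: "alike (w x) (w y)" if xy: "alike x y" and w: "w \<in> G" for w x y
    unfolding acts_alike_def
  proof
    fix z
    obtain u where "z = w u" using Inn_bij[OF w] by (metis bij_pointE)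
    then show "r z (w x) = r z (w y)"
      using w xy by (simp add: acts_alike_def flip: Inn_automorphism)
  qed
  assume w: "w \<in> G"
  have "alike x y" if "alike (w x) (w y)"
    using *[OF that Inn_inv[OF w]] Inn_bij[OF w] by (simp add: bij_is_inj)
  with * w show "alike (w x) (w y) \<longleftrightarrow> alike x y" by blast
qed

lemma alike_translate [simp]: "alike (r x z) (r y z) \<longleftrightarrow> alike x y"
  using alike_Inn[OF Inn_translation] .

lemma alikeD: "alike x y \<Longrightarrow> r z x = r z y"
  by (simp add: acts_alike_def)

lemma alike_trans: "alike x y \<Longrightarrow> alike y z \<Longrightarrow> alike x z"
  by (simp add: acts_alike_def)

lemma alike_refl [simp]: "alike x x"
  by (simp add: acts_alike_def)

text \<open>Invariance of averages. Translation on both sides is needed because on several strands an inner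
automorphism may be undone on one strand and not on the others.\<close>

lemma sum_Inn_reindex:
  assumes "a \<in> G" "b \<in> G"
  shows "(\<Sum>w\<in>G. F (a \<circ> w \<circ> b)) = (\<Sum>w\<in>G. F w)"
proof (rule sum.reindex_bij_witness[of _ "\<lambda>w. inv_into UNIV a \<circ> w \<circ> inv_into UNIV b" "\<lambda>w. a \<circ> w \<circ> b"])
  note ab = Inn_bij[OF assms(1)] Inn_bij[OF assms(2)]
  fix w assume "w \<in> G"
  show "inv_into UNIV a \<circ> (a \<circ> w \<circ> b) \<circ> inv_into UNIV b = w" "a \<circ> (inv_into UNIV a \<circ> w \<circ> inv_into UNIV b) \<circ> b = w"
    using ab by (auto simp: fun_eq_iff bij_is_inj bij_is_surj surj_f_inv_f)
  show "a \<circ> w \<circ> b \<in> G" "inv_into UNIV a \<circ> w \<circ> inv_into UNIV b \<in> G"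
    using \<open>w \<in> G\<close> assms by (auto intro!: Inn_comp Inn_inv)
qed auto

lemma sum_Inn_left: "a \<in> G \<Longrightarrow> (\<Sum>w\<in>G. F (\<lambda>x. a (w x))) = (\<Sum>w\<in>G. F w)"
  and sum_Inn_right: "b \<in> G \<Longrightarrow> (\<Sum>w\<in>G. F (\<lambda>x. w (b x))) = (\<Sum>w\<in>G. F w)"
  using sum_Inn_reindex[of a id F] sum_Inn_reindex[of id b F] by (simp_all add: Inn_id comp_def)

lemma average_const: "\<nu> * (\<Sum>w\<in>G. c) = c"
  using card_Inn_unit by (simp add: algebra_simps) (metis mult.assoc mult.commute mult_1)


section \<open>The Yang-Baxter differential in degrees one and two\<close>

text \<open>The matrix entries of \<open>c\<inverse> (g \<otimes> I + I \<otimes> g) c - (g \<otimes> I + I \<otimes> g)\<close> with \<open>c = c\<^sub>Q\<close>, that is, of the infinitesimal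
change of \<open>c\<^sub>Q\<close> under conjugation by \<open>I + g\<close>.\<close>

definition d1 :: "('q \<Rightarrow> 'q \<Rightarrow> 'a) \<Rightarrow> 'q \<times> 'q \<Rightarrow> 'q \<times> 'q \<Rightarrow> 'a" where
  "d1 g = (\<lambda>(x0, x1) (y0, y1).
     g x1 y1 * (of_bool (r x0 x1 = r y0 y1) - of_bool (x0 = y0))
     - (g x0 y0 - g (r x0 x1) (r y0 y1)) * of_bool (x1 = y1))"

text \<open>The linear part of the Yang-Baxter equation for \<open>c\<^sub>Q (II + e)\<close>. It is the alternating sum of the defects
of the three entropy equations for \<open>e\<close>, each of which vanishes if \<open>e\<close> is entropic.\<close>

definition d2 :: "('q \<times> 'q \<Rightarrow> 'q \<times> 'q \<Rightarrow> 'a) \<Rightarrow> 'q \<times> 'q \<times> 'q \<Rightarrow> 'q \<times> 'q \<times> 'q \<Rightarrow> 'a" where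
  "d2 e = (\<lambda>(x0, x1, x2) (y0, y1, y2).
     e (x1, x2) (y1, y2) * (of_bool (r (r x0 x1) x2 = r (r y0 y1) y2) - of_bool (x0 = y0))
     - (e (x0, x2) (y0, y2) * of_bool (r x1 x2 = r y1 y2)
        - e (r x0 x1, x2) (r y0 y1, y2) * of_bool (x1 = y1))
     + (e (x0, x1) (y0, y1) - e (r x0 x2, r x1 x2) (r y0 y2, r y1 y2)) * of_bool (x2 = y2))"

text \<open>Support on alike pairs, and invariance under inner automorphisms that act on the two strands
independently: entropy read off from the matrix.\<close>

definition entropic_kernel :: "('q \<times> 'q \<Rightarrow> 'q \<times> 'q \<Rightarrow> 'a) \<Rightarrow> bool" where
  "entropic_kernel h \<longleftrightarrow>
     (\<forall>x0 x1 y0 y1. h (x0, x1) (y0, y1) \<noteq> 0 \<longrightarrow> alike x0 y0 \<and> alike x1 y1) \<and>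
     (\<forall>v\<in>G. \<forall>w\<in>G. \<forall>x0 x1 y0 y1. h (v x0, w x1) (v y0, w y1) = h (x0, x1) (y0, y1))"

lemma d1_add: "d1 (\<lambda>x y. f x y + g x y) x y = d1 f x y + d1 g x y"
  by (cases x; cases y) (simp add: d1_def algebra_simps)

lemma d1_scale_sum: "d1 (\<lambda>x y. c * (\<Sum>i\<in>S. g i x y)) x y = c * (\<Sum>i\<in>S. d1 (g i) x y)"
proof (cases x; cases y)
  fix x0 x1 y0 y1 assume "x = (x0, x1)" "y = (y0, y1)"
  then show ?thesis
    by (simp add: d1_def sum.distrib sum_subtractf algebra_simps flip: sum_distrib_left sum_distrib_right)
qed

lemma d1_Inn:
  assumes "w \<in> G"
  shows "d1 g (map_prod w w x) (map_prod w w y) = d1 (\<lambda>x y. g (w x) (w y)) x y"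
  by (cases x; cases y) (simp add: d1_def assms flip: Inn_automorphism)

text \<open>Fixing the last strand turns the differential into a homotopy between a kernel and its translate; this
is why inner automorphisms act trivially on cohomology.\<close>

lemma d2_last_fixed:
  "d2 e (x0, x1, z) (y0, y1, z)
     = e (x0, x1) (y0, y1) - e (r x0 z, r x1 z) (r y0 z, r y1 z) + d1 (\<lambda>x y. e (x, z) (y, z)) (x0, x1) (y0, y1)"
  by (simp add: d1_def d2_def)

end

section \<open>Averaging a cocycle over the inner automorphisms\<close>

locale approximate_cocycle = finite_inner_rack r \<nu>
  for r :: "'q \<Rightarrow> 'q \<Rightarrow> 'q" and \<nu> :: "'a::comm_ring_1" +
  fixes I J :: "'a set" and e :: "'q \<times> 'q \<Rightarrow> 'q \<times> 'q \<Rightarrow> 'a"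
  assumes ideal_I: "is_ideal I" and ideal_J: "is_ideal J"
    and e_in: "\<And>x y. e x y \<in> I" and e_finite: "\<And>x. finite {y. e x y \<noteq> 0}"
    and cocycle: "\<And>x y. d2 e x y \<in> J"
begin

lemmas I_zero = module.subspace_0[OF module_times ideal_I]
lemmas I_neg = module.subspace_neg[OF module_times ideal_I]
lemmas I_add = module.subspace_add[OF module_times ideal_I]
lemmas I_mult = module.subspace_scale[OF module_times ideal_I]
lemmas I_sum = module.subspace_sum[OF module_times ideal_I]
lemmas J_zero = module.subspace_0[OF module_times ideal_J]
lemmas J_neg = module.subspace_neg[OF module_times ideal_J]
lemmas J_add = module.subspace_add[OF module_times ideal_J]
lemmas J_diff = module.subspace_diff[OF module_times ideal_J]
lemmas J_mult = module.subspace_scale[OF module_times ideal_J]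
lemmas J_sum = module.subspace_sum[OF module_times ideal_J]

text \<open>Row-finiteness is carried along because on an infinite rack a kernel need not define a linear map.\<close>

definition kernel1 :: "('q \<Rightarrow> 'q \<Rightarrow> 'a) \<Rightarrow> bool" where
  "kernel1 g \<longleftrightarrow> (\<forall>x y. g x y \<in> I) \<and> (\<forall>x. finite {y. g x y \<noteq> 0})"

lemma kernel1_add: "kernel1 f \<Longrightarrow> kernel1 g \<Longrightarrow> kernel1 (\<lambda>x y. f x y + g x y)"
  unfolding kernel1_def
  by (auto intro: I_add intro!: finite_subset[of "{y. f x y + g x y \<noteq> 0}" "{y. f x y \<noteq> 0} \<union> {y. g x y \<noteq> 0}" for x])

lemma kernel1_scale_sum:
  assumes "finite S" "\<And>i. i \<in> S \<Longrightarrow> kernel1 (g i)"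
  shows "kernel1 (\<lambda>x y. c * (\<Sum>i\<in>S. g i x y))"
proof -
  have "{y. c * (\<Sum>i\<in>S. g i x y) \<noteq> 0} \<subseteq> (\<Union>i\<in>S. {y. g i x y \<noteq> 0})" (is "?L x \<subseteq> ?R x") for x
    by (auto intro: ccontr sum.neutral)
  then show ?thesis using assms unfolding kernel1_def
    by (intro conjI allI I_mult I_sum finite_subset[OF \<open>?L _ \<subseteq> ?R _\<close>]) auto
qed

lemma kernel1_comp: "kernel1 g \<Longrightarrow> bij w \<Longrightarrow> kernel1 (\<lambda>x y. g (w x) (w y))"
  unfolding kernel1_def using finite_vimageI[of "{y. g (w x) y \<noteq> 0}" w for x]
  by (auto simp: bij_is_inj vimage_def)

lemma kernel1_neg: "kernel1 g \<Longrightarrow> kernel1 (\<lambda>x y. - g x y)"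
  unfolding kernel1_def by (auto intro: I_neg)

lemma d1_neg: "d1 (\<lambda>x y. - g x y) x y = - d1 g x y"
  by (cases x; cases y) (simp add: d1_def algebra_simps)

text \<open>For a translation the homotopy is the cocycle with its last strand fixed. Homotopies can be
transported along inner automorphisms and added, so the elements that have one form a group.\<close>

lemma inner_homotopy:
  assumes "w \<in> G"
  shows "\<exists>g. kernel1 g \<and> (\<forall>x y. e x y - e (map_prod w w x) (map_prod w w y) + d1 g x y \<in> J)"
  using assms
proof (induction rule: Inn_induct)
  case id
  show ?case
    by (rule exI[of _ "\<lambda>_ _. 0"]) (auto simp: kernel1_def I_zero J_zero d1_def)
next
  case (translation z)
  have "finite {y. e (x, z) (y, z) \<noteq> 0}" for x
    using finite_vimageI[OF e_finite[of "(x, z)"], of "\<lambda>y. (y, z)"] by (simp add: inj_def vimage_def)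
  then have "kernel1 (\<lambda>x y. e (x, z) (y, z))" by (auto simp: kernel1_def e_in)
  moreover have "e (x0, x1) (y0, y1) - e (r x0 z, r x1 z) (r y0 z, r y1 z)
      + d1 (\<lambda>x y. e (x, z) (y, z)) (x0, x1) (y0, y1) \<in> J" for x0 x1 y0 y1
    using cocycle[of "(x0, x1, z)" "(y0, y1, z)"] unfolding d2_last_fixed .
  ultimately show ?case by (intro exI[of _ "\<lambda>x y. e (x, z) (y, z)"]) auto
next
  case (inverse z)
  let ?s = "\<lambda>x. r x z" and ?w = "inv_into UNIV (\<lambda>x. r x z)"
  have w: "?w \<in> G" by (intro Inn_inv Inn_translation)
  let ?g = "\<lambda>x y. e (x, z) (y, z)"
  have "finite {y. e (x, z) (y, z) \<noteq> 0}" for x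
    using finite_vimageI[OF e_finite[of "(x, z)"], of "\<lambda>y. (y, z)"] by (simp add: inj_def vimage_def)
  then have k: "kernel1 ?g" by (auto simp: kernel1_def e_in)
  have step: "e (?w x0, ?w x1) (?w y0, ?w y1) - e (x0, x1) (y0, y1)
      + d1 (\<lambda>x y. ?g (?w x) (?w y)) (x0, x1) (y0, y1) \<in> J" for x0 x1 y0 y1
  proof -
    have "d1 ?g (?w x0, ?w x1) (?w y0, ?w y1) = d1 (\<lambda>x y. ?g (?w x) (?w y)) (x0, x1) (y0, y1)"
      using d1_Inn[OF w, of ?g "(x0, x1)" "(y0, y1)"] by simp
    then show ?thesis
      using cocycle[of "(?w x0, ?w x1, z)" "(?w y0, ?w y1, z)"]
      unfolding d2_last_fixed translation_inverse by simp
  qed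
  have "e x y - e (map_prod ?w ?w x) (map_prod ?w ?w y) + d1 (\<lambda>x y. - ?g (?w x) (?w y)) x y \<in> J" for x y
    using J_neg[OF step[of "fst x" "snd x" "fst y" "snd y"]]
    by (cases x; cases y) (simp add: d1_neg algebra_simps)
  moreover have "kernel1 (\<lambda>x y. - ?g (?w x) (?w y))"
    by (intro kernel1_neg kernel1_comp[OF k] Inn_bij[OF w])
  ultimately show ?case by blast
next
  case (comp a b)
  from comp.IH obtain g h where g: "kernel1 g" "\<And>x y. e x y - e (map_prod a a x) (map_prod a a y) + d1 g x y \<in> J"
    and h: "kernel1 h" "\<And>x y. e x y - e (map_prod b b x) (map_prod b b y) + d1 h x y \<in> J" by blast
  have "e x y - e (map_prod (a \<circ> b) (a \<circ> b) x) (map_prod (a \<circ> b) (a \<circ> b) y)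
      + d1 (\<lambda>x y. g (b x) (b y) + h x y) x y \<in> J" for x y
    using J_add[OF g(2)[of "map_prod b b x" "map_prod b b y"] h(2)[of x y]]
    by (simp add: d1_Inn[OF comp.hyps(2)] d1_add prod.map_comp algebra_simps)
  moreover have "kernel1 (\<lambda>x y. g (b x) (b y) + h x y)"
    by (intro kernel1_add kernel1_comp[OF g(1)] h(1) comp.hyps)
  ultimately show ?case by blast
qed

definition avg :: "'q \<times> 'q \<Rightarrow> 'q \<times> 'q \<Rightarrow> 'a" where
  "avg x y = \<nu> * (\<Sum>w\<in>G. e (map_prod w w x) (map_prod w w y))"

text \<open>The average of the homotopies of all inner automorphisms; their finite number keeps it row-finite.\<close>

lemma avg_cohomologous: "\<exists>g. kernel1 g \<and> (\<forall>x y. e x y - avg x y + d1 g x y \<in> J)"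
proof -
  from inner_homotopy obtain g where
    g: "\<And>w. w \<in> G \<Longrightarrow> kernel1 (g w)"
       "\<And>w x y. w \<in> G \<Longrightarrow> e x y - e (map_prod w w x) (map_prod w w y) + d1 (g w) x y \<in> J"
    by metis
  have "e x y - avg x y + d1 (\<lambda>x y. \<nu> * (\<Sum>w\<in>G. g w x y)) x y
      = \<nu> * (\<Sum>w\<in>G. e x y - e (map_prod w w x) (map_prod w w y) + d1 (g w) x y)" for x y
    unfolding d1_scale_sum avg_def sum.distrib sum_subtractf ring_distribs average_const right_diff_distrib ..
  moreover have "\<nu> * (\<Sum>w\<in>G. e x y - e (map_prod w w x) (map_prod w w y) + d1 (g w) x y) \<in> J" for x y
    by (intro J_mult J_sum g)
  moreover have "kernel1 (\<lambda>x y. \<nu> * (\<Sum>w\<in>G. g w x y))"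
    by (intro kernel1_scale_sum finite_Inn g)
  ultimately show ?thesis by (metis (no_types, lifting))
qed

lemma avg_in: "avg x y \<in> I"
  unfolding avg_def by (intro I_mult I_sum e_in)

lemma avg_finite: "finite {y. avg x y \<noteq> 0}"
proof -
  have "{y. avg x y \<noteq> 0} \<subseteq> (\<Union>w\<in>G. map_prod w w -` {y. e (map_prod w w x) y \<noteq> 0})"
    unfolding avg_def by (auto intro: ccontr sum.neutral)
  then show ?thesis
    by (rule finite_subset) (intro finite_UN_I finite_Inn finite_vimageI e_finite prod.inj_map bij_is_inj Inn_bij)
qed

lemma avg_Inn: "v \<in> G \<Longrightarrow> avg (v x0, v x1) (v y0, v y1) = avg (x0, x1) (y0, y1)"
  unfolding avg_def
  using sum_Inn_right[of v "\<lambda>w. e (w x0, w x1) (w y0, w y1)"] by simp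

lemma avg_translate: "avg (r x0 z, r x1 z) (r y0 z, r y1 z) = avg (x0, x1) (y0, y1)"
  using avg_Inn[OF Inn_translation] .

lemma d2_avg: "d2 avg x y \<in> J"
proof (cases x; cases y)
  fix x0 x1 x2 y0 y1 y2 assume [simp]: "x = (x0, x1, x2)" "y = (y0, y1, y2)"
  have "d2 avg x y = \<nu> * (\<Sum>w\<in>G. d2 e (w x0, w x1, w x2) (w y0, w y1, w y2))"
    by (simp add: d2_def avg_def Inn_automorphism[symmetric] sum.distrib sum_subtractf algebra_simps
        flip: sum_distrib_left sum_distrib_right cong: sum.cong)
  then show "d2 avg x y \<in> J" by (auto intro!: J_mult J_sum cocycle)
qed

end

section \<open>Reducing an equivariant cocycle to its entropic part\<close>

context approximate_cocycle
begin

text \<open>For an equivariant kernel the last of the three parts of the cocycle identity drops out.\<close>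

lemma avg_face:
  "avg (x1, x2) (y1, y2) * (of_bool (r (r x0 x1) x2 = r (r y0 y1) y2) - of_bool (x0 = y0))
   - (avg (x0, x2) (y0, y2) * of_bool (r x1 x2 = r y1 y2)
      - avg (r x0 x1, x2) (r y0 y1, y2) * of_bool (x1 = y1)) \<in> J"
  using d2_avg[of "(x0, x1, x2)" "(y0, y1, y2)"] by (cases "x2 = y2") (auto simp: d2_def avg_translate)

text \<open>If the second coordinates are alike, the reduced identity with equal middle strands \<open>z\<close> loses its first
part and compares the entry with its translate by \<open>z\<close> on the left strand alone.\<close>

lemma avg_translate_left:
  assumes "alike x1 y1"
  shows "avg (x0, x1) (y0, y1) - avg (r x0 z, x1) (r y0 z, y1) \<in> J"
proof -
  have "r (r x0 z) x1 = r (r y0 z) y1 \<longleftrightarrow> x0 = y0" "r z x1 = r z y1"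
    using alikeD[OF assms] by (metis translation_cancel)+
  then show ?thesis
    using J_neg[OF avg_face[of z x1 z y1 x0 y0]] by simp
qed

lemma avg_Inn_left:
  assumes "w \<in> G" "alike x1 y1"
  shows "avg (x0, x1) (y0, y1) - avg (w x0, x1) (w y0, y1) \<in> J"
  using assms(1)
proof (induction arbitrary: x0 y0 rule: Inn_induct)
  case id
  show ?case by (simp add: J_zero)
next
  case (translation z)
  show ?case by (rule avg_translate_left[OF assms(2)])
next
  case (inverse z)
  show ?case
    using J_neg[OF avg_translate_left[OF assms(2), of "inv_into UNIV (\<lambda>x. r x z) x0" "inv_into UNIV (\<lambda>x. r x z) y0" z]]
    by (simp add: translation_inverse)
next
  case (comp a b)
  show ?case
    using J_add[OF comp.IH(1)[of "b x0" "b y0"] comp.IH(2)[of x0 y0]] by simp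
qed

text \<open>Since \<open>x\<^sub>0\<close> and \<open>y\<^sub>0\<close> differ, only the first part of the reduced identity can survive. On an outer strand that tells
them apart its coefficient is \<open>-1\<close>.\<close>

lemma avg_unlike_left:
  assumes "alike x1 y1" "\<not> alike x0 y0"
  shows "avg (x0, x1) (y0, y1) \<in> J"
proof -
  obtain u where u: "r u x0 \<noteq> r u y0" using assms(2) by (auto simp: acts_alike_def)
  then have "x0 \<noteq> y0" by auto
  moreover have "r (r u x0) x1 \<noteq> r (r u y0) y1" "r x0 x1 \<noteq> r y0 y1"
    using u \<open>x0 \<noteq> y0\<close> alikeD[OF assms(1)] by (metis translation_cancel)+
  ultimately show ?thesis
    using J_neg[OF avg_face[of x0 x1 y0 y1 u u]] by simp
qed

text \<open>With \<open>z\<close> on both middle strands and \<open>z\<close> telling \<open>x\<^sub>1\<close> and \<open>y\<^sub>1\<close> apart, one of the two terms of the middle face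
vanishes. What remains expresses every entry through the single number at \<open>(z, x\<^sub>1), (z, y\<^sub>1)\<close>, in the shape of
a coboundary.\<close>

lemma avg_separated:
  assumes "r z x1 \<noteq> r z y1"
  shows "avg (x0, x1) (y0, y1)
    + avg (z, x1) (z, y1) * (of_bool (r x0 x1 = r y0 y1) - of_bool (x0 = y0)) \<in> J"
proof -
  obtain u v where uv: "x0 = r u z" "y0 = r v z" using translation_surj by metis
  show ?thesis
    using avg_face[of z x1 z y1 u v] assms unfolding uv by (simp add: algebra_simps)
qed

text \<open>The separating element is chosen as a function of the two translations and not of the two rack elements.
There are only finitely many translations, which is what makes the resulting homotopy row-finite.\<close>

definition sep :: "('q \<Rightarrow> 'q) \<Rightarrow> ('q \<Rightarrow> 'q) \<Rightarrow> 'q" where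
  "sep a b = (SOME z. a z \<noteq> b z)"

definition unlike_homotopy :: "'q \<Rightarrow> 'q \<Rightarrow> 'a" where
  "unlike_homotopy x y = (if alike x y then 0 else
     let z = sep (\<lambda>u. r u x) (\<lambda>u. r u y) in avg (z, x) (z, y))"

text \<open>Up to \<open>J\<close> the choice of the separating element does not matter, because the formula for separated
entries also applies to the entry at another separating element.\<close>

lemma unlike_homotopy_cong:
  assumes "r z x \<noteq> r z y"
  shows "unlike_homotopy x y - avg (z, x) (z, y) \<in> J"
proof -
  define s where "s = sep (\<lambda>u. r u x) (\<lambda>u. r u y)"
  have s: "r s x \<noteq> r s y" unfolding s_def sep_def by (rule someI) (rule assms)
  have "\<not> alike x y" using assms by (auto simp: acts_alike_def)
  then show ?thesis
    using avg_separated[OF assms, of s s] s by (simp add: unlike_homotopy_def s_def[symmetric])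
qed

lemma unlike_homotopy_translate:
  "unlike_homotopy x y - unlike_homotopy (r x z) (r y z) \<in> J"
proof (cases "alike x y")
  case True
  then show ?thesis by (simp add: unlike_homotopy_def J_zero)
next
  case False
  then obtain u where u: "r u x \<noteq> r u y" by (auto simp: acts_alike_def)
  then have u': "r (r u z) (r x z) \<noteq> r (r u z) (r y z)"
    by (simp flip: self_distributive)
  show ?thesis
    using J_diff[OF unlike_homotopy_cong[OF u] unlike_homotopy_cong[OF u']] by (simp add: avg_translate)
qed

lemma kernel1_unlike_homotopy: "kernel1 unlike_homotopy"
  unfolding kernel1_def
proof (intro conjI allI)
  fix x y
  show "unlike_homotopy x y \<in> I"
    by (auto simp: unlike_homotopy_def Let_def I_zero avg_in)
  let ?z = "\<lambda>b. sep (\<lambda>u. r u x) b"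
  have "{y. unlike_homotopy x y \<noteq> 0} \<subseteq> (\<Union>b\<in>G. (\<lambda>y. (?z b, y)) -` {p. avg (?z b, x) p \<noteq> 0})"
    using Inn_translation by (auto simp: unlike_homotopy_def Let_def split: if_splits)
  then show "finite {y. unlike_homotopy x y \<noteq> 0}"
    by (rule finite_subset) (intro finite_UN_I finite_Inn finite_vimageI avg_finite injI, simp)
qed

text \<open>Averaging over the left strand alone suffices: together with equivariance under the diagonal action this
gives invariance on each strand.\<close>

definition entropic_part :: "'q \<times> 'q \<Rightarrow> 'q \<times> 'q \<Rightarrow> 'a" where
  "entropic_part = (\<lambda>(x0, x1) (y0, y1). if alike x0 y0 \<and> alike x1 y1
     then \<nu> * (\<Sum>w\<in>G. avg (w x0, x1) (w y0, y1)) else 0)"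

lemma avg_cohomologous_entropic_part:
  "avg x y + d1 unlike_homotopy x y - entropic_part x y \<in> J"
proof (cases x; cases y)
  fix x0 x1 y0 y1 assume xy [simp]: "x = (x0, x1)" "y = (y0, y1)"
  let ?t = "(unlike_homotopy x0 y0 - unlike_homotopy (r x0 x1) (r y0 y1)) * of_bool (x1 = y1)"
  have t: "?t \<in> J"
    using unlike_homotopy_translate[of x0 y0 x1] by (cases "x1 = y1") (auto simp: J_zero)
  consider "alike x0 y0" "alike x1 y1" | "\<not> alike x0 y0" "alike x1 y1" | "\<not> alike x1 y1" by blast
  then show "avg x y + d1 unlike_homotopy x y - entropic_part x y \<in> J"
  proof cases
    case 1
    have "avg x y - entropic_part x y = \<nu> * (\<Sum>w\<in>G. avg (x0, x1) (y0, y1) - avg (w x0, x1) (w y0, y1))"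
      using 1 by (simp add: entropic_part_def sum_subtractf right_diff_distrib average_const del: sum_constant)
    also have "\<dots> \<in> J" by (intro J_mult J_sum avg_Inn_left 1)
    finally show ?thesis
      using J_diff[OF _ t, of "avg x y - entropic_part x y"] 1
      by (simp add: d1_def unlike_homotopy_def[of x1 y1] algebra_simps)
  next
    case 2
    then show ?thesis
      using J_diff[OF avg_unlike_left[OF 2(2,1)] t]
      by (simp add: d1_def unlike_homotopy_def[of x1 y1] entropic_part_def)
  next
    case 3
    then obtain z where z: "r z x1 \<noteq> r z y1" by (auto simp: acts_alike_def)
    define b :: 'a where "b = of_bool (r x0 x1 = r y0 y1) - of_bool (x0 = y0)"
    have "avg x y + avg (z, x1) (z, y1) * b \<in> J"
      using avg_separated[OF z, of x0 y0] by (simp add: b_def)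
    from J_add[OF this J_mult[OF unlike_homotopy_cong[OF z], of b]]
    have "avg x y + avg (z, x1) (z, y1) * b + b * (unlike_homotopy x1 y1 - avg (z, x1) (z, y1)) \<in> J" .
    moreover have "x1 \<noteq> y1" using 3 by auto
    then have "d1 unlike_homotopy x y = b * unlike_homotopy x1 y1" "entropic_part x y = 0"
      using 3 by (simp_all add: d1_def b_def entropic_part_def mult.commute)
    ultimately show ?thesis by (simp add: algebra_simps)
  qed
qed

lemma entropic_part_entropic: "entropic_kernel entropic_part"
  unfolding entropic_kernel_def
proof (intro conjI ballI allI impI)
  fix x0 x1 y0 y1 v w assume vw: "v \<in> G" "w \<in> G"
  have "avg (u (v x0), w x1) (u (v y0), w y1) = avg ((inv_into UNIV w \<circ> u \<circ> v) x0, x1) ((inv_into UNIV w \<circ> u \<circ> v) y0, y1)" for u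
    using avg_Inn[OF Inn_inv[OF vw(2)], of "u (v x0)" "w x1" "u (v y0)" "w y1"] Inn_bij[OF vw(2)]
    by (simp add: bij_is_inj)
  then have "(\<Sum>u\<in>G. avg (u (v x0), w x1) (u (v y0), w y1)) = (\<Sum>u\<in>G. avg (u x0, x1) (u y0, y1))"
    using sum_Inn_reindex[OF Inn_inv[OF vw(2)] vw(1), of "\<lambda>u. avg (u x0, x1) (u y0, y1)"] by simp
  then show "entropic_part (v x0, w x1) (v y0, w y1) = entropic_part (x0, x1) (y0, y1)"
    using vw by (simp add: entropic_part_def)
qed (auto simp: entropic_part_def split: if_splits)

lemma entropic_part_in: "entropic_part x y \<in> I"
  by (cases x; cases y) (auto simp: entropic_part_def intro!: I_zero I_mult I_sum avg_in)

lemma entropic_part_finite: "finite {y. entropic_part x y \<noteq> 0}"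
proof -
  obtain x0 x1 where x: "x = (x0, x1)" by (cases x)
  have "{y. entropic_part x y \<noteq> 0} \<subseteq> (\<Union>w\<in>G. map_prod w id -` {y. avg (w x0, x1) y \<noteq> 0})"
    unfolding x entropic_part_def by (auto split: if_splits intro: ccontr sum.neutral)
  then show ?thesis
    by (rule finite_subset)
       (intro finite_UN_I finite_Inn finite_vimageI avg_finite prod.inj_map bij_is_inj Inn_bij bij_id)
qed

lemma cohomologous_to_entropic:
  obtains g h where "kernel1 g" "entropic_kernel h" "\<And>x y. h x y \<in> I" "\<And>x. finite {y. h x y \<noteq> 0}"
    "\<And>x y. e x y + d1 g x y - h x y \<in> J"
proof -
  from avg_cohomologous obtain g where g: "kernel1 g" "\<And>x y. e x y - avg x y + d1 g x y \<in> J" by blast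
  have "e x y + d1 (\<lambda>x y. g x y + unlike_homotopy x y) x y - entropic_part x y \<in> J" for x y
    using J_add[OF g(2) avg_cohomologous_entropic_part, of x y x y] by (simp add: d1_add algebra_simps)
  then show thesis
    by (rule that[OF kernel1_add[OF g(1) kernel1_unlike_homotopy] entropic_part_entropic
          entropic_part_in entropic_part_finite])
qed

end

section \<open>The obstruction on three strands\<close>

text \<open>A rearrangement that brings to the inside the summation variables in which the respective face terms
cancel.\<close>

lemma sum_rotate_diff:
  fixes A B :: "'u \<Rightarrow> 'u \<Rightarrow> 'u \<Rightarrow> 'b::ab_group_add"
  shows "(\<Sum>u\<in>S. \<Sum>v\<in>S. \<Sum>w\<in>S. B u v w - A u v w)
    = (\<Sum>w\<in>S. \<Sum>u\<in>S. \<Sum>v\<in>S. B u v w) - (\<Sum>v\<in>S. \<Sum>w\<in>S. \<Sum>u\<in>S. A u v w)"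
proof -
  have "(\<Sum>u\<in>S. \<Sum>v\<in>S. \<Sum>w\<in>S. A u v w) = (\<Sum>v\<in>S. \<Sum>w\<in>S. \<Sum>u\<in>S. A u v w)" for A :: "'u \<Rightarrow> 'u \<Rightarrow> 'u \<Rightarrow> 'b"
    by (rule trans[OF sum.swap], rule sum.cong[OF refl], rule sum.swap)
  from this[of A] this[of "\<lambda>w u v. B u v w", symmetric] show ?thesis
    by (simp only: sum_subtractf)
qed

context finite_inner_rack
begin

text \<open>Each of the three faces averages to zero on its own. On alike entries the first is zero term by term, and
in the other two the translation that distinguishes the two terms is absorbed into the summation over
the strands on which it acts.\<close>

lemma d2_diagonal_average:
  assumes "alike x0 y0" "alike x1 y1" "alike x2 y2"
  shows "(\<Sum>u\<in>G. \<Sum>v\<in>G. \<Sum>w\<in>G. d2 e (u x0, v x1, w x2) (u y0, v y1, w y2)) = 0"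
proof -
  have same1: "r (r (u x0) (v x1)) (w x2) = r (r (u y0) (v y1)) (w y2) \<longleftrightarrow> x0 = y0"
    if "u \<in> G" "v \<in> G" "w \<in> G" for u v w
  proof -
    have "alike (v x1) (v y1)" "alike (w x2) (w y2)" using assms that by simp_all
    then have "r (r (u x0) (v x1)) (w x2) = r (r (u y0) (v y1)) (w y2) \<longleftrightarrow> u x0 = u y0"
      by (metis alikeD translation_cancel)
    then show ?thesis using that by simp
  qed
  have same2: "r (v x1) (w x2) = r (v y1) (w y2) \<longleftrightarrow> x1 = y1" if "v \<in> G" "w \<in> G" for v w
  proof -
    have "alike (w x2) (w y2)" using assms that by simp
    then have "r (v x1) (w x2) = r (v y1) (w y2) \<longleftrightarrow> v x1 = v y1" by (metis alikeD translation_cancel)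
    then show ?thesis using that by simp
  qed
  have face2: "(\<Sum>u\<in>G. e (r (u x0) (v x1), w x2) (r (u y0) (v y1), w y2) * of_bool (x1 = y1))
      = (\<Sum>u\<in>G. e (u x0, w x2) (u y0, w y2) * of_bool (x1 = y1))" for v w
    using sum_Inn_left[OF Inn_translation[of "v x1"], of "\<lambda>u. e (u x0, w x2) (u y0, w y2) * of_bool (x1 = y1)"]
    by (cases "x1 = y1") auto
  have face3: "(\<Sum>u\<in>G. \<Sum>v\<in>G. e (r (u x0) (w x2), r (v x1) (w x2)) (r (u y0) (w y2), r (v y1) (w y2))
        * of_bool (x2 = y2))
      = (\<Sum>u\<in>G. \<Sum>v\<in>G. e (u x0, v x1) (u y0, v y1) * of_bool (x2 = y2))" (is "?l = ?r") for w
  proof (cases "x2 = y2")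
    case True
    let ?s = "\<lambda>x. r x (w x2)"
    have "?l = (\<Sum>u\<in>G. \<Sum>v\<in>G. e (?s (u x0), ?s (v x1)) (?s (u y0), ?s (v y1)))" using True by simp
    also have "\<dots> = (\<Sum>u\<in>G. \<Sum>v\<in>G. e (u x0, ?s (v x1)) (u y0, ?s (v y1)))"
      by (rule sum_Inn_left[OF Inn_translation, of "\<lambda>u. \<Sum>v\<in>G. e (u x0, ?s (v x1)) (u y0, ?s (v y1))"])
    also have "\<dots> = (\<Sum>u\<in>G. \<Sum>v\<in>G. e (u x0, v x1) (u y0, v y1))"
      by (intro sum.cong refl sum_Inn_left[OF Inn_translation, of "\<lambda>v. e (_ x0, v x1) (_ y0, v y1)"])
    finally show ?thesis using True by simp
  qed simp
  have "(\<Sum>u\<in>G. \<Sum>v\<in>G. \<Sum>w\<in>G. d2 e (u x0, v x1, w x2) (u y0, v y1, w y2))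
      = (\<Sum>u\<in>G. \<Sum>v\<in>G. \<Sum>w\<in>G.
          (e (u x0, v x1) (u y0, v y1) * of_bool (x2 = y2)
             - e (r (u x0) (w x2), r (v x1) (w x2)) (r (u y0) (w y2), r (v y1) (w y2)) * of_bool (x2 = y2))
          - (e (u x0, w x2) (u y0, w y2) * of_bool (x1 = y1)
             - e (r (u x0) (v x1), w x2) (r (u y0) (v y1), w y2) * of_bool (x1 = y1)))"
    by (intro sum.cong refl) (simp add: d2_def same1 same2 algebra_simps)
  also have "\<dots> = 0"
    by (subst sum_rotate_diff) (simp only: sum_subtractf face2 face3 diff_self sum.neutral_const)
  finally show ?thesis .
qed

text \<open>An entry of \<open>N\<close> off the quasi-diagonal is zero, and one on it is the average of itself and so, modulo \<open>J\<close>,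
minus an average of the differential.\<close>

lemma entropic_obstruction_vanishes:
  fixes N :: "'q \<times> 'q \<times> 'q \<Rightarrow> 'q \<times> 'q \<times> 'q \<Rightarrow> 'a"
  assumes J: "is_ideal J"
    and quasi_diagonal: "\<And>x0 x1 x2 y0 y1 y2. N (x0, x1, x2) (y0, y1, y2) \<noteq> 0
          \<Longrightarrow> alike x0 y0 \<and> alike x1 y1 \<and> alike x2 y2"
    and invariant: "\<And>u v w x0 x1 x2 y0 y1 y2. u \<in> G \<Longrightarrow> v \<in> G \<Longrightarrow> w \<in> G
          \<Longrightarrow> N (u x0, v x1, w x2) (u y0, v y1, w y2) = N (x0, x1, x2) (y0, y1, y2)"
    and sum_in: "\<And>x y. N x y + d2 e x y \<in> J"
  shows "N x y \<in> J"
proof (cases x; cases y)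
  fix x0 x1 x2 y0 y1 y2 assume xy: "x = (x0, x1, x2)" "y = (y0, y1, y2)"
  show "N x y \<in> J"
  proof (cases "N x y = 0")
    case True
    then show ?thesis using module.subspace_0[OF module_times J] by simp
  next
    case False
    note al = quasi_diagonal[OF False[unfolded xy]]
    have "(\<Sum>u\<in>G. \<Sum>v\<in>G. \<Sum>w\<in>G. N x y + d2 e (u x0, v x1, w x2) (u y0, v y1, w y2)) \<in> J"
    proof (intro module.subspace_sum[OF module_times J])
      fix u v w assume "u \<in> G" "v \<in> G" "w \<in> G"
      then show "N x y + d2 e (u x0, v x1, w x2) (u y0, v y1, w y2) \<in> J"
        using sum_in[of "(u x0, v x1, w x2)" "(u y0, v y1, w y2)"] by (simp add: xy invariant)
    qed
    then have "(\<Sum>u\<in>G. \<Sum>v\<in>G. \<Sum>w\<in>G. N x y) \<in> J"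
      using d2_diagonal_average[of x0 y0 x1 y1 x2 y2 e] al by (simp add: sum.distrib del: sum_constant)
    from module.subspace_scale[OF module_times J this, of "\<nu> * \<nu> * \<nu>"]
    show ?thesis
      by (simp only: mult.assoc sum_distrib_left[of \<nu> "\<lambda>_. sum _ _"] average_const)
  qed
qed

end

section \<open>Congruence modulo an ideal\<close>

lemma sum_in_ideal: "is_ideal I \<Longrightarrow> (\<And>x. x \<in> S \<Longrightarrow> f x \<in> I) \<Longrightarrow> sum f S \<in> I"
  by (rule module.subspace_sum[OF module_times])

lemma ideal_mult_left: "is_ideal I \<Longrightarrow> a \<in> I \<Longrightarrow> b * a \<in> I"
  using ideal_mult_right[of I a b] by (simp add: mult.commute)

text \<open>The congruence \<open>f \<equiv> g\<close> modulo \<open>I\<close> of maps becomes \<open>f - g \<in> endos_in I\<close> (\<open>cong_maps_iff_endos_in\<close>).\<close>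

definition endos_in :: "'a::comm_ring_1 set \<Rightarrow> ('x, 'a) endo set" where
  "endos_in I = {f. \<forall>x y. coef f x y \<in> I}"

lemma coef_endos_in: "f \<in> endos_in I \<Longrightarrow> coef f x y \<in> I"
  by (simp add: endos_in_def)

lemma endos_inI: "(\<And>x y. coef f x y \<in> I) \<Longrightarrow> f \<in> endos_in I"
  by (simp add: endos_in_def)

lemma endos_in_mono: "I \<subseteq> J \<Longrightarrow> endos_in I \<subseteq> endos_in J"
  by (auto simp: endos_in_def)

lemma endos_in_prod:
  assumes "is_ideal L" "\<And>a b. a \<in> I \<Longrightarrow> b \<in> J \<Longrightarrow> a * b \<in> L" "f \<in> endos_in I" "g \<in> endos_in J"
  shows "f * g \<in> endos_in L" "g * f \<in> endos_in L"
proof -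
  note c = coef_endos_in[OF assms(3)] coef_endos_in[OF assms(4)]
  show "g * f \<in> endos_in L"
    using assms(2) c by (intro endos_inI) (auto simp: coef_mult intro!: sum_in_ideal[OF assms(1)])
  have "coef g x y * coef f y z \<in> L" for x y z
    using assms(2)[OF c] by (metis mult.commute)
  then show "f * g \<in> endos_in L"
    by (intro endos_inI) (auto simp: coef_mult intro!: sum_in_ideal[OF assms(1)])
qed

definition two_sided_ideal :: "'r::ring_1 set \<Rightarrow> bool" where
  "two_sided_ideal K \<longleftrightarrow> 0 \<in> K \<and> (\<forall>a\<in>K. \<forall>b\<in>K. a - b \<in> K) \<and> (\<forall>a\<in>K. \<forall>b. a * b \<in> K \<and> b * a \<in> K)"

lemma two_sided_idealD:
  assumes "two_sided_ideal K"
  shows two_sided_zero: "0 \<in> K"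
    and two_sided_diff: "a \<in> K \<Longrightarrow> b \<in> K \<Longrightarrow> a - b \<in> K"
    and two_sided_add: "a \<in> K \<Longrightarrow> b \<in> K \<Longrightarrow> a + b \<in> K"
    and two_sided_neg: "a \<in> K \<Longrightarrow> - a \<in> K"
    and two_sided_right: "a \<in> K \<Longrightarrow> a * c \<in> K"
    and two_sided_left: "a \<in> K \<Longrightarrow> c * a \<in> K"
proof -
  note K = assms[unfolded two_sided_ideal_def]
  show neg: "- a \<in> K" if "a \<in> K" for a
    using K that by (metis diff_0)
  show "a \<in> K \<Longrightarrow> b \<in> K \<Longrightarrow> a + b \<in> K"
    using K neg[of b] by (metis diff_minus_eq_add)
qed (use assms in \<open>auto simp: two_sided_ideal_def\<close>)

lemma endos_in_two_sided:
  assumes "is_ideal I" shows "two_sided_ideal (endos_in I :: ('x, 'a::comm_ring_1) endo set)"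
proof -
  have UNIV: "f \<in> endos_in UNIV" for f :: "('x, 'a) endo"
    by (simp add: endos_in_def)
  show ?thesis
    unfolding two_sided_ideal_def
    using endos_in_prod[OF assms ideal_mult_right[OF assms] _ UNIV]
    by (auto simp: endos_in_def coef_simps module.subspace_0[OF module_times assms]
        intro: module.subspace_diff[OF module_times assms])
qed

lemma tens_endos_in:
  assumes "is_ideal I" "f \<in> endos_in I"
  shows "tens f g \<in> endos_in I" "tens g f \<in> endos_in I"
  using assms(2) by (auto simp: endos_in_def coef_tens intro: ideal_mult_left[OF assms(1)] ideal_mult_right[OF assms(1)])

lemma first_endos_in: "is_ideal I \<Longrightarrow> f \<in> endos_in I \<Longrightarrow> first f \<in> endos_in I"
  by (auto simp: endos_in_def coef_first intro: ideal_mult_right module.subspace_0[OF module_times])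

lemma final_endos_in: "is_ideal I \<Longrightarrow> f \<in> endos_in I \<Longrightarrow> final f \<in> endos_in I"
  by (auto simp: endos_in_def coef_final intro: ideal_mult_left module.subspace_0[OF module_times])

lemma cong_maps_iff_endos_in:
  assumes "is_ideal I"
  shows "cong_maps I (app f) (app g) \<longleftrightarrow> f - g \<in> endos_in I"
proof -
  have "cong_maps I (app f) (app g) \<longleftrightarrow> (\<forall>v y. Poly_Mapping.lookup (app (f - g) v) y \<in> I)"
    unfolding cong_maps_def ideal_times_fscale[OF assms] app_simps by simp
  also have "\<dots> \<longleftrightarrow> f - g \<in> endos_in I"
  proof
    assume "f - g \<in> endos_in I"
    then show "\<forall>v y. Poly_Mapping.lookup (app (f - g) v) y \<in> I"
      by (subst lookup_flinear[OF flinear_app])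
         (auto simp: endos_in_def coef_def intro!: sum_in_ideal[OF assms] ideal_mult_left[OF assms])
  qed (simp add: endos_in_def coef_def)
  finally show ?thesis .
qed

lemma ideal_power_Suc_subset:
  assumes "is_ideal m"
  shows "ideal_power m (Suc n) \<subseteq> m" "ideal_power m (Suc n) \<subseteq> ideal_power m n"
  unfolding ideal_power.simps
  by (rule module.span_minimal[OF module_times];
      auto intro: ideal_mult_right[OF assms] ideal_mult_left[OF is_ideal_ideal_power] assms is_ideal_ideal_power)+

lemma ideal_power_Suc_mult: "a \<in> m \<Longrightarrow> b \<in> ideal_power m n \<Longrightarrow> a * b \<in> ideal_power m (Suc n)"
  by (auto intro: module.span_base[OF module_times])

lemma endos_in_power_Suc:
  assumes "f \<in> endos_in m" "g \<in> endos_in (ideal_power m n)"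
  shows "f * g \<in> endos_in (ideal_power m (Suc n))" "g * f \<in> endos_in (ideal_power m (Suc n))"
  by (rule endos_in_prod[OF is_ideal_ideal_power ideal_power_Suc_mult assms]; assumption)+


section \<open>Limits in the endomorphism ring of a complete module\<close>

lemma endo_separated:
  assumes "adic_complete ((*) :: 'a \<Rightarrow> 'a \<Rightarrow> 'a) (m :: 'a::comm_ring_1 set)"
    and "\<And>n. f \<in> endos_in (ideal_power m n)"
  shows "f = 0"
proof (rule endo_eqI)
  fix x y
  show "coef f x y = coef 0 x y"
    using assms unfolding adic_complete_iff[OF module_times] ideal_times_self[OF is_ideal_ideal_power]
    by (auto simp: endos_in_def coef_simps)
qed

text \<open>The limit is taken on basis vectors and extended linearly, since congruences between linear maps can be
checked on a basis.\<close>

lemma endo_limit: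
  fixes X :: "nat \<Rightarrow> ('x, 'a::comm_ring_1) endo"
  assumes "adic_complete (fscale :: 'a \<Rightarrow> ('x \<Rightarrow>\<^sub>0 'a) \<Rightarrow> _) m"
    and X: "\<And>n. X (Suc n) - X n \<in> endos_in (ideal_power m n)"
  obtains Y where "\<And>n. Y - X n \<in> endos_in (ideal_power m n)"
proof -
  note lim = conjunct2[OF assms(1)[unfolded adic_complete_iff[OF module_fscale] ideal_times_fscale[OF is_ideal_ideal_power]]]
  have "\<exists>v. \<forall>n. v - app (X n) (fbasis x) \<in> {v. \<forall>y. Poly_Mapping.lookup v y \<in> ideal_power m n}" for x
    using X by (intro lim[rule_format]) (simp add: endos_in_def coef_def app_simps)
  then obtain \<phi> where
    \<phi>: "\<And>x n. \<phi> x - app (X n) (fbasis x) \<in> {v. \<forall>y. Poly_Mapping.lookup v y \<in> ideal_power m n}" by metis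
  have "app (endo (fextend \<phi>)) (fbasis x) = \<phi> x" for x by (simp add: endo_inverse)
  then show thesis
    using \<phi> by (intro that[of "endo (fextend \<phi>)"]) (simp add: endos_in_def coef_def app_simps)
qed

lemma neumann_inverse:
  fixes g :: "('x, 'a::comm_ring_1) endo"
  assumes m: "is_ideal m" and ring: "adic_complete ((*) :: 'a \<Rightarrow> 'a \<Rightarrow> 'a) m"
    and module: "adic_complete (fscale :: 'a \<Rightarrow> ('x \<Rightarrow>\<^sub>0 'a) \<Rightarrow> _) m"
    and g: "g \<in> endos_in m"
  shows "\<exists>b. b * (1 + g) = 1 \<and> (1 + g) * b = 1"
proof -
  have power: "(- g) ^ n \<in> endos_in (ideal_power m n)" for n
  proof (induction n)
    case (Suc n)
    have "- g \<in> endos_in m" using g by (rule two_sided_neg[OF endos_in_two_sided[OF m]])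
    then show ?case
      unfolding power_Suc by (rule endos_in_power_Suc(1)[OF _ Suc])
  qed (simp add: endos_in_def)
  define X where "X n = (\<Sum>k<n. (- g) ^ k)" for n
  have geometric: "X n * (1 + g) = 1 - (- g) ^ n" "(1 + g) * X n = 1 - (- g) ^ n" for n
  proof -
    show "(1 + g) * X n = 1 - (- g) ^ n"
      by (induction n) (auto simp: X_def algebra_simps)
    show "X n * (1 + g) = 1 - (- g) ^ n"
      using power_commutes[of "- g"] by (induction n) (auto simp: X_def algebra_simps)
  qed
  have "X (Suc n) - X n \<in> endos_in (ideal_power m n)" for n
    using power by (simp add: X_def)
  with module obtain Y where Y: "\<And>n. Y - X n \<in> endos_in (ideal_power m n)"
    using endo_limit[of m X] by blast
  note K = endos_in_two_sided[OF is_ideal_ideal_power]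
  have "Y * (1 + g) - 1 \<in> endos_in (ideal_power m n)" for n
  proof -
    have "Y * (1 + g) - 1 = (Y - X n) * (1 + g) - (- g) ^ n"
      using geometric(1)[of n] by (simp add: left_diff_distrib)
    then show ?thesis
      using two_sided_diff[OF K two_sided_right[OF K Y] power] by simp
  qed
  moreover have "(1 + g) * Y - 1 \<in> endos_in (ideal_power m n)" for n
  proof -
    have "(1 + g) * Y - 1 = (1 + g) * (Y - X n) - (- g) ^ n"
      using geometric(2)[of n] by (simp add: right_diff_distrib)
    then show ?thesis
      using two_sided_diff[OF K two_sided_left[OF K Y] power] by simp
  qed
  ultimately have "Y * (1 + g) - 1 = 0" "(1 + g) * Y - 1 = 0"
    using endo_separated[OF ring] by blast+
  then show ?thesis by auto
qed

section \<open>The Yang-Baxter equation to first order\<close>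

text \<open>Products of two perturbations are negligible, and so is the product of a perturbation with the distance
of a factor from its leading term.\<close>

lemma perturbed_triple_product:
  fixes a b c :: "'r::ring_1"
  assumes K: "two_sided_ideal K" and S: "two_sided_ideal S" and "S \<subseteq> M"
    and SM: "\<forall>s\<in>S. \<forall>t\<in>M. s * t \<in> K \<and> t * s \<in> K"
    and xyz: "x \<in> S" "y \<in> S" "z \<in> S" and abc: "a - a0 \<in> M" "b - b0 \<in> M" "c - c0 \<in> M"
  shows "(a + x) * (b + y) * (c + z) - (a * b * c + (x * b0 * c0 + a0 * y * c0 + a0 * b0 * z)) \<in> K"
proof -
  have SK: "s * t \<in> K" and KS: "t * s \<in> K" if "s \<in> S" "t \<in> M" for s t
    using SM that by auto
  have SS: "s * t \<in> K" if "s \<in> S" "t \<in> S" for s t using SK that \<open>S \<subseteq> M\<close> by blast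
  have "(a + x) * (b + y) * (c + z) - (a * b * c + (x * b0 * c0 + a0 * y * c0 + a0 * b0 * z))
      = x * (b - b0) * c + (x * b0) * (c - c0) + ((a - a0) * y) * c + a0 * (y * (c - c0))
        + (a - a0) * (b * z) + a0 * ((b - b0) * z) + x * (y * c) + x * (b * z) + a * (y * z) + x * (y * z)"
    by (simp add: algebra_simps)
  also have "\<dots> \<in> K"
    by (rule two_sided_add[OF K] two_sided_right[OF K SK[OF xyz(1) abc(2)]]
        SK[OF two_sided_right[OF S xyz(1)] abc(3)] two_sided_right[OF K KS[OF xyz(2) abc(1)]]
        two_sided_left[OF K SK[OF xyz(2) abc(3)]] KS[OF two_sided_left[OF S xyz(3)] abc(1)]
        two_sided_left[OF K KS[OF xyz(3) abc(2)]] SS[OF xyz(1) two_sided_right[OF S xyz(2)]]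
        SS[OF xyz(1) two_sided_left[OF S xyz(3)]] two_sided_left[OF K SS[OF xyz(2,3)]])+
  finally show ?thesis .
qed

text \<open>Sliding the \<open>F\<close> through the braids collects them on one side and exposes the braid word as a common factor.
In the linear terms each \<open>F\<close> may be replaced by the identity.\<close>

lemma braid_first_order:
  fixes c1 c2 F1 F2 F13 E1 E2 :: "'r::ring_1"
  assumes K: "two_sided_ideal K" and S: "two_sided_ideal S" and M: "two_sided_ideal M" and "S \<subseteq> M"
    and SM: "\<forall>s\<in>S. \<forall>t\<in>M. s * t \<in> K \<and> t * s \<in> K"
    and E: "E1 \<in> S" "E2 \<in> S" and F: "F1 - 1 \<in> M" "F2 - 1 \<in> M"
    and braid: "c1 * c2 * c1 = c2 * c1 * c2"
    and slide: "F1 * (c2 * c1) = c2 * c1 * F2" "F1 * c2 = c2 * F13" "F2 * c1 = c1 * F13"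
      "F2 * (c1 * c2) = c1 * c2 * F1"
    and yb: "(c1 * (F1 + E1)) * (c2 * (F2 + E2)) * (c1 * (F1 + E1))
           = (c2 * (F2 + E2)) * (c1 * (F1 + E1)) * (c2 * (F2 + E2))"
  shows "c1 * c2 * c1 * (F2 * F13 * F1 - F1 * F13 * F2)
    + (c1 * E1 * c2 * c1 + c1 * c2 * E2 * c1 + c1 * c2 * c1 * E1
       - (c2 * E2 * c1 * c2 + c2 * c1 * E1 * c2 + c2 * c1 * c2 * E2)) \<in> K"
proof -
  have cF: "c1 * F1 - c1 \<in> M" "c2 * F2 - c2 \<in> M"
    using two_sided_left[OF M F(1), of c1] two_sided_left[OF M F(2), of c2] by (simp_all add: algebra_simps)
  have cE: "c1 * E1 \<in> S" "c2 * E2 \<in> S" using E by (auto intro: two_sided_left[OF S])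
  note triple = perturbed_triple_product[OF K S \<open>S \<subseteq> M\<close> SM]
  have "(c1 * F1) * (c2 * F2) * (c1 * F1) = c1 * (F1 * (c2 * c1)) * F13 * F1"
    using slide(3) by (simp add: mult.assoc) (metis mult.assoc)
  also have "\<dots> = c1 * c2 * c1 * (F2 * F13 * F1)"
    by (simp add: slide(1) mult.assoc)
  finally have l: "(c1 * F1) * (c2 * F2) * (c1 * F1) = c1 * c2 * c1 * (F2 * F13 * F1)" .
  have "(c2 * F2) * (c1 * F1) * (c2 * F2) = c2 * (F2 * (c1 * c2)) * F13 * F2"
    using slide(2) by (simp add: mult.assoc) (metis mult.assoc)
  also have "\<dots> = c1 * c2 * c1 * (F1 * F13 * F2)"
    unfolding braid by (simp add: slide(4) mult.assoc)
  finally have rr: "(c2 * F2) * (c1 * F1) * (c2 * F2) = c1 * c2 * c1 * (F1 * F13 * F2)" .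
  define P where "P = (c1 * F1 + c1 * E1) * (c2 * F2 + c2 * E2) * (c1 * F1 + c1 * E1)"
  have P': "P = (c2 * F2 + c2 * E2) * (c1 * F1 + c1 * E1) * (c2 * F2 + c2 * E2)"
    using yb unfolding P_def by (simp only: distrib_left)
  let ?U = "c1 * E1 * c2 * c1 + c1 * (c2 * E2) * c1 + c1 * c2 * (c1 * E1)"
  let ?V = "c2 * E2 * c1 * c2 + c2 * (c1 * E1) * c2 + c2 * c1 * (c2 * E2)"
  have "P - (c1 * c2 * c1 * (F2 * F13 * F1) + ?U) \<in> K"
    using triple[OF cE(1,2,1) cF(1,2,1)] unfolding l P_def .
  moreover have "P - (c1 * c2 * c1 * (F1 * F13 * F2) + ?V) \<in> K"
    using triple[OF cE(2,1,2) cF(2,1,2)] unfolding rr P' .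
  ultimately have "(P - (c1 * c2 * c1 * (F1 * F13 * F2) + ?V)) - (P - (c1 * c2 * c1 * (F2 * F13 * F1) + ?U)) \<in> K"
    by (rule two_sided_diff[OF K, rotated])
  then show ?thesis by (simp add: right_diff_distrib mult.assoc algebra_simps)
qed

section \<open>Entropic endomorphisms\<close>

context finite_inner_rack
begin

definition braid :: "'q \<times> 'q \<Rightarrow> 'q \<times> 'q" where
  "braid = (\<lambda>(x, y). (y, r x y))"

definition braid1 :: "'q \<times> 'q \<times> 'q \<Rightarrow> 'q \<times> 'q \<times> 'q" where
  "braid1 = (\<lambda>(x, y, z). (y, r x y, z))"

definition braid2 :: "'q \<times> 'q \<times> 'q \<Rightarrow> 'q \<times> 'q \<times> 'q" where
  "braid2 = (\<lambda>(x, y, z). (x, z, r y z))"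

abbreviation C :: "('q \<times> 'q, 'a) endo" where "C \<equiv> perm braid"
abbreviation C1 :: "('q \<times> 'q \<times> 'q, 'a) endo" where "C1 \<equiv> perm braid1"
abbreviation C2 :: "('q \<times> 'q \<times> 'q, 'a) endo" where "C2 \<equiv> perm braid2"

lemma bij_braid: "bij braid"
proof (rule bijI)
  have "(y, w) \<in> range braid" for y w
  proof -
    obtain x where "w = r x y" using translation_surj by blast
    then show ?thesis by (intro image_eqI[of _ _ "(x, y)"]) (simp_all add: braid_def)
  qed
  then show "surj braid" by auto
qed (auto simp: inj_def braid_def)

lemma bij_braid1: "bij braid1"
proof (rule bijI)
  have "(y, w, z) \<in> range braid1" for y w z
  proof -
    obtain x where "w = r x y" using translation_surj by blast
    then show ?thesis by (intro image_eqI[of _ _ "(x, y, z)"]) (simp_all add: braid1_def)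
  qed
  then show "surj braid1" by auto
qed (auto simp: inj_def braid1_def)

lemma bij_braid2: "bij braid2"
proof (rule bijI)
  have "(x, z, w) \<in> range braid2" for x z w
  proof -
    obtain y where "w = r y z" using translation_surj by blast
    then show ?thesis by (intro image_eqI[of _ _ "(x, y, z)"]) (simp_all add: braid2_def)
  qed
  then show "surj braid2" by auto
qed (auto simp: inj_def braid2_def)

lemma app_C: "app C = rack_op r"
  unfolding perm_def rack_op_def braid_def by (simp add: endo_inverse split_def)

lemma first_C: "first C = C1"
  by (rule endo_eqI) (clarsimp simp: coef_first coef_perm braid_def braid1_def of_bool_conj mult.assoc)

lemma final_C: "final C = C2"
  by (rule endo_eqI) (clarsimp simp: coef_final coef_perm braid_def braid2_def of_bool_conj mult.assoc)

lemma C_braid_relation: "C1 * C2 * C1 = C2 * C1 * C2"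
  unfolding perm_comp
  by (rule arg_cong[of _ _ perm]) (auto simp: braid1_def braid2_def self_distributive[symmetric])

lemma C_inverse: "perm (inv_into UNIV braid) * C = 1" "C * perm (inv_into UNIV braid) = 1"
  using bij_braid
  by (simp_all add: perm_comp perm_id bij_is_inj bij_is_surj surj_iff[THEN iffD1] del: id_apply)

definition entropic_endo :: "('q \<times> 'q, 'a) endo \<Rightarrow> bool" where
  "entropic_endo f \<longleftrightarrow> entropic_kernel (coef f)"

lemma entropic_zero:
  assumes "entropic_endo f" "\<not> (alike x0 y0 \<and> alike x1 y1)"
  shows "coef f (x0, x1) (y0, y1) = 0"
  using assms unfolding entropic_endo_def entropic_kernel_def by blast

lemma entropic_Inn:
  assumes "entropic_endo f" "v \<in> G" "w \<in> G"
  shows "coef f (v x0, w x1) (v y0, w y1) = coef f (x0, x1) (y0, y1)"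
  using assms unfolding entropic_endo_def entropic_kernel_def by blast

lemma entropic_translate:
  assumes "entropic_endo f"
  shows "coef f (r x0 z, x1) (r y0 z, y1) = coef f (x0, x1) (y0, y1)"
    and "coef f (x0, r x1 z) (y0, r y1 z) = coef f (x0, x1) (y0, y1)"
  using entropic_Inn[OF assms Inn_translation Inn_id] entropic_Inn[OF assms Inn_id Inn_translation]
  by auto

lemma entropic_one: "entropic_endo 1"
  unfolding entropic_endo_def entropic_kernel_def by (auto simp: coef_simps)

lemma entropic_add: "entropic_endo f \<Longrightarrow> entropic_endo g \<Longrightarrow> entropic_endo (f + g)"
  unfolding entropic_endo_def entropic_kernel_def coef_simps by (metis add.right_neutral)

definition middle :: "('q \<times> 'q, 'a) endo \<Rightarrow> ('q \<times> 'q \<times> 'q, 'a) endo" where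
  "middle f = perm (inv_into UNIV braid2) * first f * C2"

lemma coef_conj:
  fixes f :: "('x, 'a) endo"
  assumes "bij \<sigma>"
  shows "coef (perm (inv_into UNIV \<sigma>) * f * perm \<sigma>) x y = coef f (\<sigma> x) (\<sigma> y)"
  using coef_perm_mult[of "inv_into UNIV \<sigma>" f "\<sigma> x" "\<sigma> y"] assms
  by (simp add: bij_imp_bij_inv bij_is_inj)

text \<open>The braid carries the middle strand past the last one. Being alike, \<open>x\<^sub>2\<close> and \<open>y\<^sub>2\<close> act on it in the same way,
so \<open>middle f\<close> simply acts on the outer strands and leaves the middle one alone.\<close>

lemma coef_middle:
  assumes "entropic_endo f"
  shows "coef (middle f) (x0, x1, x2) (y0, y1, y2) = coef f (x0, x2) (y0, y2) * of_bool (x1 = y1)"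
proof -
  have "coef (middle f) (x0, x1, x2) (y0, y1, y2) = coef f (x0, x2) (y0, y2) * of_bool (r x1 x2 = r y1 y2)"
    unfolding middle_def coef_conj[OF bij_braid2] by (simp add: braid2_def coef_first)
  moreover have "r x1 x2 = r y1 y2 \<longleftrightarrow> x1 = y1" if "alike x2 y2"
    using alikeD[OF that] by (metis translation_cancel)
  ultimately show ?thesis
    using entropic_zero[OF assms, of x0 y0 x2 y2] by (cases "alike x2 y2") auto
qed

text \<open>Moving \<open>f\<close> past a strand has two effects on the matrix: the strand is acted upon by the inputs and outputs
of \<open>f\<close>, which act alike, and the inputs and outputs are translated by the strand, which does not change the entry.\<close>

lemma entropic_slides:
  assumes "entropic_endo f"
  shows "first f * (C2 * C1) = C2 * C1 * final f"
    and "first f * C2 = C2 * middle f"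
    and "final f * C1 = C1 * middle f"
    and "final f * (C1 * C2) = C1 * C2 * first f"
proof -
  show "first f * (C2 * C1) = C2 * C1 * final f"
    unfolding perm_comp
  proof (rule perm_intertwines; clarify?)
    show "bij (braid2 \<circ> braid1)" by (intro bij_comp bij_braid1 bij_braid2)
    fix x0 x1 x2 y0 y1 y2
    have "r (r x0 x1) x2 = r (r y0 y1) y2 \<longleftrightarrow> x0 = y0" if "alike x1 y1" "alike x2 y2"
      using alikeD[OF that(1)] alikeD[OF that(2)] by (metis translation_cancel)
    then show "coef (first f) ((braid2 \<circ> braid1) (x0, x1, x2)) ((braid2 \<circ> braid1) (y0, y1, y2))
        = coef (final f) (x0, x1, x2) (y0, y1, y2)"
      using entropic_zero[OF assms, of x1 y1 x2 y2]
      by (cases "alike x1 y1 \<and> alike x2 y2") (auto simp: braid1_def braid2_def coef_first coef_final)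
  qed
  show "first f * C2 = C2 * middle f"
    using coef_conj[OF bij_braid2, of "first f"] unfolding middle_def
    by (intro perm_intertwines bij_braid2) simp
  show "final f * C1 = C1 * middle f"
    by (rule perm_intertwines[OF bij_braid1])
       (auto simp: coef_middle[OF assms] braid1_def coef_final entropic_translate[OF assms])
  show "final f * (C1 * C2) = C1 * C2 * first f"
    unfolding perm_comp
    by (rule perm_intertwines[OF bij_comp[OF bij_braid2 bij_braid1]])
       (auto simp: braid1_def braid2_def coef_first coef_final entropic_translate[OF assms])
qed

lemma entropic_of_entropic_endo:
  assumes "entropic_endo f"
  shows "entropic r (app f)"
proof -
  let ?c1 = "on_first (rack_op r :: ('q \<times> 'q \<Rightarrow>\<^sub>0 'a) \<Rightarrow> _)" and ?c2 = "on_last (rack_op r :: ('q \<times> 'q \<Rightarrow>\<^sub>0 'a) \<Rightarrow> _)"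
  have c: "?c1 = app C1" "?c2 = app C2"
    by (simp_all add: app_first app_final app_C flip: first_C final_C)
  have comp: "app g \<circ> app h = app (g * h)" for g h :: "('q \<times> 'q \<times> 'q, 'a) endo"
    by (simp add: fun_eq_iff app_simps)
  have inj_perm: "inj (app (perm \<sigma> :: ('x, 'a) endo))" if "bij \<sigma>" for \<sigma> :: "'x \<Rightarrow> 'x"
  proof (rule inj_on_inverseI)
    have "perm (inv_into UNIV \<sigma>) * perm \<sigma> = (1 :: ('x, 'a) endo)"
      using that by (simp add: perm_comp bij_is_inj perm_id)
    then show "app (perm (inv_into UNIV \<sigma>)) (app (perm \<sigma>) v) = v" for v :: "'x \<Rightarrow>\<^sub>0 'a"
      by (simp flip: app_simps(5)) (simp add: app_simps)
  qed
  note inj = inj_perm[OF bij_braid1] inj_perm[OF bij_braid2]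
    inj_perm[OF bij_comp[OF bij_braid1 bij_braid2]] inj_perm[OF bij_comp[OF bij_braid2 bij_braid1]]
  have cancel: "inv_into UNIV (app p) \<circ> app (p * g) = app g" if "inj (app p)" for p g :: "('q \<times> 'q \<times> 'q, 'a) endo"
    using that by (simp add: fun_eq_iff app_simps)
  note slides = entropic_slides[OF assms]
  have inj': "inj (app (C2 * C1))" "inj (app (C1 * C2))" using inj by (simp_all add: perm_comp)
  show ?thesis
    unfolding entropic_def Let_def c app_first[symmetric] app_final[symmetric]
    by (simp only: comp comp_assoc flinear_app slides cancel inj inj' simp_thms)
qed

text \<open>Invariance is phrased as commutation with permutations, which is visibly stable under products.\<close>

definition entropic_cube :: "('q \<times> 'q \<times> 'q, 'a) endo \<Rightarrow> bool" where
  "entropic_cube f \<longleftrightarrow>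
     (\<forall>x0 x1 x2 y0 y1 y2. coef f (x0, x1, x2) (y0, y1, y2) \<noteq> 0 \<longrightarrow> alike x0 y0 \<and> alike x1 y1 \<and> alike x2 y2) \<and>
     (\<forall>u\<in>G. \<forall>v\<in>G. \<forall>w\<in>G. f * perm (map_prod u (map_prod v w)) = perm (map_prod u (map_prod v w)) * f)"

lemma bij_map_prod3: "u \<in> G \<Longrightarrow> v \<in> G \<Longrightarrow> w \<in> G \<Longrightarrow> bij (map_prod u (map_prod v w))"
  by (metis Inn_bij bij_def map_prod_surj prod.inj_map)

lemma entropic_cube_faces:
  assumes "entropic_endo f"
  shows "entropic_cube (first f)" "entropic_cube (final f)" "entropic_cube (middle f)"
  unfolding entropic_cube_def using entropic_zero[OF assms]
  by (auto simp: coef_first coef_final coef_middle[OF assms] entropic_Inn[OF assms]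
      intro!: perm_intertwines bij_map_prod3)

lemma entropic_cube_mult:
  assumes "entropic_cube f" "entropic_cube g"
  shows "entropic_cube (g * f)"
  unfolding entropic_cube_def
proof (intro conjI allI ballI impI)
  fix u v w assume "u \<in> G" "v \<in> G" "w \<in> G"
  then have "f * perm (map_prod u (map_prod v w)) = perm (map_prod u (map_prod v w)) * f"
    "g * perm (map_prod u (map_prod v w)) = perm (map_prod u (map_prod v w)) * g"
    using assms unfolding entropic_cube_def by blast+
  then show "g * f * perm (map_prod u (map_prod v w)) = perm (map_prod u (map_prod v w)) * (g * f)"
    by (simp add: mult.assoc) (simp flip: mult.assoc)
next
  fix x0 x1 x2 y0 y1 y2 assume "coef (g * f) (x0, x1, x2) (y0, y1, y2) \<noteq> 0"
  then have "\<exists>z. coef f (x0, x1, x2) z * coef g z (y0, y1, y2) \<noteq> 0"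
    unfolding coef_mult by (rule contrapos_np) (auto intro: sum.neutral)
  then obtain z0 z1 z2 where "coef f (x0, x1, x2) (z0, z1, z2) * coef g (z0, z1, z2) (y0, y1, y2) \<noteq> 0"
    by auto
  then have "coef f (x0, x1, x2) (z0, z1, z2) \<noteq> 0" "coef g (z0, z1, z2) (y0, y1, y2) \<noteq> 0" by auto
  then show "alike x0 y0" "alike x1 y1" "alike x2 y2"
    using assms unfolding entropic_cube_def by (blast intro: alike_trans)+
qed

lemma entropic_cube_diff:
  assumes "entropic_cube f" "entropic_cube g"
  shows "entropic_cube (f - g)"
  using assms unfolding entropic_cube_def
  by (auto simp: coef_simps algebra_simps) (metis diff_self)+

lemma entropic_cube_Inn:
  assumes "entropic_cube f" "u \<in> G" "v \<in> G" "w \<in> G"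
  shows "coef f (u x0, v x1, w x2) (u y0, v y1, w y2) = coef f (x0, x1, x2) (y0, y1, y2)"
proof -
  let ?p = "map_prod u (map_prod v w)"
  have "coef (f * perm ?p) (x0, x1, x2) (?p (y0, y1, y2)) = coef (perm ?p * f) (x0, x1, x2) (?p (y0, y1, y2))"
    using assms unfolding entropic_cube_def by simp
  then show ?thesis
    using coef_perm_mult[OF bij_is_inj[OF bij_map_prod3[OF assms(2-4)]], of f "(x0, x1, x2)" "(y0, y1, y2)"]
    by simp
qed

end

section \<open>One step of the deformation\<close>

declare ideal_power.simps(2) [simp del]

definition yang_baxter_endo :: "('x \<times> 'x, 'a::comm_ring_1) endo \<Rightarrow> bool" where
  "yang_baxter_endo c \<longleftrightarrow> first c * final c * first c = final c * first c * final c"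

abbreviation tens2 :: "('x, 'a::comm_ring_1) endo \<Rightarrow> ('x \<times> 'x, 'a) endo" where
  "tens2 b \<equiv> tens b b"

lemma yang_baxter_conjugate:
  assumes "yang_baxter_endo c" "c' * tens2 b = tens2 b * c" "b * b' = 1"
  shows "yang_baxter_endo c'"
proof -
  let ?T = "tens b (tens b b)" and ?T' = "tens b' (tens b' b')"
  note i = tensor_cube_intertwines[OF assms(2)]
  have TT: "?T * ?T' = 1" by (simp add: tens_mult assms(3) tens_one)
  have "first c' * final c' * first c' * ?T = ?T * (first c * final c * first c)"
    using i by (simp add: mult.assoc) (simp flip: mult.assoc)
  also have "\<dots> = ?T * (final c * first c * final c)"
    using assms(1) by (simp add: yang_baxter_endo_def)
  also have "\<dots> = final c' * first c' * final c' * ?T"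
    using i by (simp add: mult.assoc) (simp flip: mult.assoc)
  finally have "first c' * final c' * first c' * (?T * ?T') = final c' * first c' * final c' * (?T * ?T')"
    by (simp flip: mult.assoc)
  then show ?thesis unfolding TT yang_baxter_endo_def by simp
qed

context finite_inner_rack
begin

text \<open>The Yang-Baxter equation yields only the sum of the obstruction \<open>N\<close> and the differential of \<open>e\<close>. The former
is entropic and vanishes by averaging, and then so does the latter.\<close>

lemma differential_small:
  assumes m: "is_ideal m" and I: "is_ideal I" and J: "is_ideal J" and "I \<subseteq> m"
    and mI: "\<And>a b. a \<in> m \<Longrightarrow> b \<in> I \<Longrightarrow> a * b \<in> J"
    and yb: "yang_baxter_endo (C * (f + e))"
    and f: "entropic_endo f" "f - 1 \<in> endos_in m" and e: "e \<in> endos_in I"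
  shows "d2 (coef e) x y \<in> J"
proof -
  define N where "N = final f * middle f * first f - first f * middle f * final f"
  define D where "D = C1 * first e * C2 * C1 + C1 * C2 * final e * C1 + C1 * C2 * C1 * first e
       - (C2 * final e * C1 * C2 + C2 * C1 * first e * C2 + C2 * C1 * C2 * final e)"
  have "\<forall>s\<in>endos_in I. \<forall>t\<in>endos_in m. s * t \<in> endos_in J \<and> t * s \<in> endos_in J"
    using endos_in_prod[OF J mI] by blast
  moreover have "first f - 1 \<in> endos_in m" "final f - 1 \<in> endos_in m"
    using first_endos_in[OF m f(2)] final_endos_in[OF m f(2)] first_add[of "f - 1" 1] final_add[of "f - 1" 1]
    by (simp_all add: first_def[of 1] final_def[of 1] tens_one reassoc_one algebra_simps)
  ultimately have ND: "C1 * C2 * C1 * N + D \<in> endos_in J"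
    unfolding N_def D_def
    by (intro braid_first_order[where S = "endos_in I" and M = "endos_in m"])
       (use yb in \<open>simp_all add: yang_baxter_endo_def first_mult final_mult first_add final_add first_C final_C
          endos_in_two_sided m I J endos_in_mono \<open>I \<subseteq> m\<close> first_endos_in final_endos_in e
          C_braid_relation entropic_slides[OF f(1)]\<close>)
  let ?s = "braid1 \<circ> braid2 \<circ> braid1"
  have s': "?s = braid2 \<circ> braid1 \<circ> braid2"
    by (auto simp: braid1_def braid2_def fun_eq_iff self_distributive[symmetric])
  note inj = bij_is_inj[OF bij_braid1] bij_is_inj[OF bij_braid2]
  \<comment> \<open>Column indices are twisted by the full braid so that the common factor \<open>C\<^sub>1 C\<^sub>2 C\<^sub>1\<close> disappears from the entries.\<close>
  have two: "coef (perm \<sigma> * perm \<tau> * g) x (\<sigma> (\<tau> y)) = coef g x y" if "inj \<sigma>" "inj \<tau>"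
    for \<sigma> \<tau> x y and g :: "('q \<times> 'q \<times> 'q, 'a) endo"
    using that by (simp add: coef_perm_mult mult.assoc)
  have three: "coef (perm \<sigma> * perm \<tau> * perm \<rho> * g) x (\<sigma> (\<tau> (\<rho> y))) = coef g x y"
    if "inj \<sigma>" "inj \<tau>" "inj \<rho>" for \<sigma> \<tau> \<rho> x y and g :: "('q \<times> 'q \<times> 'q, 'a) endo"
    using that by (simp add: coef_perm_mult mult.assoc)
  have "coef N x y + d2 (coef e) x y = coef (C1 * C2 * C1 * N + D) x (?s y)" for x y
  proof -
    have s1: "?s y = braid1 (braid2 (braid1 y))" by simp
    \<comment> \<open>Each group of terms is evaluated in the form of the full twist that matches its leftmost factors.\<close>
    have s2: "?s y = braid2 (braid1 (braid2 y))" unfolding s' by simp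
    have "coef (C1 * first e * C2 * C1) x (?s y) = coef (first e) (braid2 (braid1 x)) (braid2 (braid1 y))"
      "coef (C1 * C2 * final e * C1) x (?s y) = coef (final e) (braid1 x) (braid1 y)"
      "coef (C1 * C2 * C1 * first e) x (?s y) = coef (first e) x y"
      "coef (C1 * C2 * C1 * N) x (?s y) = coef N x y"
      unfolding s1 using inj by (simp_all add: coef_perm_mult two three)
    moreover have "coef (C2 * final e * C1 * C2) x (?s y) = coef (final e) (braid1 (braid2 x)) (braid1 (braid2 y))"
      "coef (C2 * C1 * first e * C2) x (?s y) = coef (first e) (braid2 x) (braid2 y)"
      "coef (C2 * C1 * C2 * final e) x (?s y) = coef (final e) x y"
      unfolding s2 using inj by (simp_all add: coef_perm_mult two three)
    ultimately show ?thesis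
      unfolding D_def coef_simps
      by (cases x; cases y) (simp add: d2_def braid1_def braid2_def coef_first coef_final algebra_simps)
  qed
  then have sum: "coef N x y + d2 (coef e) x y \<in> J" for x y
    using coef_endos_in[OF ND] by simp
  have cube: "entropic_cube N"
    unfolding N_def by (intro entropic_cube_diff entropic_cube_mult entropic_cube_faces f(1))
  have "coef N x y \<in> J" for x y
  proof (rule entropic_obstruction_vanishes[OF J _ _ sum])
    show "alike x0 y0 \<and> alike x1 y1 \<and> alike x2 y2" if "coef N (x0, x1, x2) (y0, y1, y2) \<noteq> 0" for x0 x1 x2 y0 y1 y2
      using cube that unfolding entropic_cube_def by blast
  qed (use entropic_cube_Inn[OF cube] in auto)
  from module.subspace_diff[OF module_times J sum this, of x y x y] show ?thesis by simp
qed

text \<open>One step of the construction. To first order conjugation by \<open>I + g\<close> adds \<open>c\<^sub>Q d g\<close> to \<open>c\<close>, and \<open>g\<close> is chosen such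
that \<open>e + d g\<close> is entropic modulo \<open>J\<close>.\<close>

lemma entropic_improvement:
  assumes m: "is_ideal m" and I: "is_ideal I" and J: "is_ideal J" and "I \<subseteq> m"
    and mI: "\<And>a b. a \<in> m \<Longrightarrow> b \<in> I \<Longrightarrow> a * b \<in> J"
    and inverse: "\<And>g :: ('q, 'a) endo. g \<in> endos_in m \<Longrightarrow> \<exists>b. b * (1 + g) = 1 \<and> (1 + g) * b = 1"
    and yb: "yang_baxter_endo c"
    and f: "entropic_endo f" "f - 1 \<in> endos_in m" and c: "c - C * f \<in> endos_in I"
  shows "\<exists>g c' f'. g \<in> endos_in I \<and> yang_baxter_endo c' \<and> c' * tens2 (1 + g) = tens2 (1 + g) * c
    \<and> entropic_endo f' \<and> f' - 1 \<in> endos_in m \<and> c' - C * f' \<in> endos_in J"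
proof -
  note KI = endos_in_two_sided[OF I] and KJ = endos_in_two_sided[OF J] and Km = endos_in_two_sided[OF m]
  define e where "e = perm (inv_into UNIV braid) * c - f"
  have ce: "c = C * (f + e)"
    using C_inverse(2) by (simp add: e_def flip: mult.assoc)
  have "e = perm (inv_into UNIV braid) * (c - C * f)"
    using C_inverse(1) by (simp add: e_def right_diff_distrib flip: mult.assoc)
  then have e: "e \<in> endos_in I" using two_sided_left[OF KI c] by simp
  interpret approximate_cocycle r \<nu> I J "coef e"
  proof
    show "d2 (coef e) x y \<in> J" for x y
      by (rule differential_small[OF m I J \<open>I \<subseteq> m\<close> mI yb[unfolded ce] f e])
  qed (use I J coef_endos_in[OF e] finite_coef in auto)
  obtain g0 h0 where g0: "kernel1 g0" and h0: "entropic_kernel h0" "\<And>x y. h0 x y \<in> I" "\<And>x. finite {y. h0 x y \<noteq> 0}"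
    and eq0: "\<And>x y. coef e x y + d1 g0 x y - h0 x y \<in> J"
    using cohomologous_to_entropic by blast
  define g where "g = of_kernel g0"
  define h where "h = of_kernel h0"
  have cg: "coef g = g0" using g0 by (intro ext) (simp add: g_def coef_of_kernel kernel1_def)
  have ch: "coef h = h0" using h0(3) by (intro ext) (simp add: h_def coef_of_kernel)
  have g: "g \<in> endos_in I" using g0 by (simp add: endos_in_def cg kernel1_def)
  have h: "h \<in> endos_in I" using h0(2) by (simp add: endos_in_def ch)
  have Im: "x \<in> endos_in I \<Longrightarrow> x \<in> endos_in m" for x :: "('x, 'a) endo"
    using endos_in_mono[OF \<open>I \<subseteq> m\<close>] by blast
  have prod: "x * y \<in> endos_in J" "y * x \<in> endos_in J" if "x \<in> endos_in m" "y \<in> endos_in I" for x y :: "('x, 'a) endo"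
    using endos_in_prod[OF J mI that] by auto
  obtain b where b: "b * (1 + g) = 1" "(1 + g) * b = 1" using inverse[OF Im[OF g]] by blast
  define A where "A = tens2 (1 + g)"
  have AB: "A * tens2 b = 1" by (simp add: A_def tens_mult b tens_one)
  have BA: "tens2 b * A = 1" by (simp add: A_def tens_mult b tens_one)
  define c' where "c' = A * c * tens2 b"
  have c'A: "c' * A = A * c" unfolding c'_def by (simp add: mult.assoc BA)
  define d where "d = tens g 1 + tens 1 g"
  define a where "a = d + tens g g"
  have d: "d \<in> endos_in I"
    unfolding d_def by (intro two_sided_add[OF KI] tens_endos_in[OF I] g)
  have gg: "tens g g \<in> endos_in J"
    using mI coef_endos_in[OF Im[OF g]] coef_endos_in[OF g] by (auto simp: endos_in_def coef_tens)
  have a: "a \<in> endos_in I"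
    unfolding a_def by (intro two_sided_add[OF KI] d tens_endos_in[OF I] g)
  have A: "A = 1 + a"
    by (simp add: A_def a_def d_def tens_add_left tens_add_right tens_one algebra_simps)
  define u where "u = c' - c"
  have uA: "u * A = a * c - c * a"
    unfolding u_def left_diff_distrib c'A by (simp add: A algebra_simps)
  have "u = (a * c - c * a) * tens2 b"
    using AB by (simp flip: uA) (simp add: mult.assoc)
  then have u: "u \<in> endos_in I"
    by (simp add: two_sided_right[OF KI] two_sided_left[OF KI] two_sided_diff[OF KI] a)
  define w where "w = c - C"
  have "w = (c - C * f) + C * (f - 1)" by (simp add: w_def algebra_simps)
  then have w: "w \<in> endos_in m"
    using two_sided_add[OF Km Im[OF c] two_sided_left[OF Km f(2)]] by simp
  \<comment> \<open>This is \<open>u A = a c - c a\<close> with the leading terms split off; every term on the right has two small factors.\<close>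
  have "u - (d * C - C * d) = (a * w + tens g g * C) - (w * a + C * tens g g) - u * a"
    using uA by (simp add: A w_def a_def algebra_simps)
  also have "\<dots> \<in> endos_in J"
    by (intro two_sided_diff[OF KJ] two_sided_add[OF KJ] two_sided_left[OF KJ] two_sided_right[OF KJ] gg
        prod(2)[OF w a] prod(1)[OF w a] prod(1)[OF Im[OF u] a])
  finally have first_order: "u - (d * C - C * d) \<in> endos_in J" .
  have second: "C * (e - h) + (d * C - C * d) \<in> endos_in J"
  proof (rule endos_inI)
    fix x y
    obtain y' where y: "y = braid y'" using bij_braid by (metis bij_pointE)
    have "coef (C * (e - h) + (d * C - C * d)) x y = coef e x y' + d1 g0 x y' - h0 x y'"
      unfolding y coef_simps coef_perm_mult[OF bij_is_inj[OF bij_braid]] coef_mult_perm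
      by (cases x; cases y') (simp add: d1_def d_def braid_def coef_tens coef_simps cg ch algebra_simps)
    then show "coef (C * (e - h) + (d * C - C * d)) x y \<in> J" using eq0 by simp
  qed
  have "c' - C * (f + h) = (u - (d * C - C * d)) + (C * (e - h) + (d * C - C * d))"
    by (simp add: u_def ce algebra_simps)
  then have "c' - C * (f + h) \<in> endos_in J"
    using two_sided_add[OF KJ first_order second] by (simp only:)
  moreover have "entropic_endo (f + h)"
    using h0(1) by (intro entropic_add f(1)) (simp add: entropic_endo_def ch)
  moreover have "f + h - 1 \<in> endos_in m"
    using two_sided_add[OF Km f(2) Im[OF h]] by (simp add: algebra_simps)
  moreover have "yang_baxter_endo c'"
    by (rule yang_baxter_conjugate[OF yb c'A[unfolded A_def] b(2)])
  ultimately show ?thesis using g c'A unfolding A_def by blast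
qed

section \<open>Deforming to an entropic operator\<close>

text \<open>The change of basis \<open>b\<close> is recorded through the intertwining relation, so that no inverses have to be carried
through the recursion.\<close>

definition entropic_modulo :: "'a set \<Rightarrow> 'a set \<Rightarrow> ('q \<times> 'q, 'a) endo \<Rightarrow> ('q, 'a) endo \<Rightarrow> bool" where
  "entropic_modulo I m c b \<longleftrightarrow> b - 1 \<in> endos_in m \<and>
     (\<exists>c' f. yang_baxter_endo c' \<and> c' * tens2 b = tens2 b * c
        \<and> entropic_endo f \<and> f - 1 \<in> endos_in m \<and> c' - C * f \<in> endos_in I)"

text \<open>Successive changes of basis differ by a left factor \<open>I + g\<close> with \<open>g\<close> in ever higher powers of \<open>m\<close>, which makes
the sequence converge.\<close>

lemma entropic_approximations:
  assumes m: "is_ideal m"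
    and inverse: "\<And>g :: ('q, 'a) endo. g \<in> endos_in m \<Longrightarrow> \<exists>b. b * (1 + g) = 1 \<and> (1 + g) * b = 1"
    and yb: "yang_baxter_endo c" and cC: "c - C \<in> endos_in m"
  shows "\<exists>\<beta>. \<forall>k. entropic_modulo (ideal_power m (Suc k)) m c (\<beta> k)
    \<and> \<beta> (Suc k) - \<beta> k \<in> endos_in (ideal_power m k)"
proof (rule dependent_nat_choice)
  have "m \<subseteq> ideal_power m (Suc 0)"
    using ideal_power_Suc_mult[of _ m 1 0] by auto
  then have "c - C * 1 \<in> endos_in (ideal_power m (Suc 0))"
    using cC endos_in_mono by (metis mult_1_right subsetD)
  moreover have "(1 :: ('q, 'a) endo) - 1 \<in> endos_in m" "(1 :: ('q \<times> 'q, 'a) endo) - 1 \<in> endos_in m"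
    using two_sided_zero[OF endos_in_two_sided[OF m]] by simp_all
  moreover have "c * tens2 1 = tens2 1 * c" by (simp add: tens_one)
  ultimately have "entropic_modulo (ideal_power m (Suc 0)) m c 1"
    unfolding entropic_modulo_def using yb entropic_one by blast
  then show "\<exists>\<beta>. entropic_modulo (ideal_power m (Suc 0)) m c \<beta>" by blast
next
  note K = endos_in_two_sided[OF is_ideal_ideal_power] and Km = endos_in_two_sided[OF m]
  fix \<beta> k assume "entropic_modulo (ideal_power m (Suc k)) m c \<beta>"
  then obtain c' f where \<beta>: "\<beta> - 1 \<in> endos_in m" and c': "yang_baxter_endo c'" "c' * tens2 \<beta> = tens2 \<beta> * c"
    and f: "entropic_endo f" "f - 1 \<in> endos_in m" "c' - C * f \<in> endos_in (ideal_power m (Suc k))"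
    unfolding entropic_modulo_def by blast
  obtain g c'' f' where g: "g \<in> endos_in (ideal_power m (Suc k))" and c'': "yang_baxter_endo c''"
      "c'' * tens2 (1 + g) = tens2 (1 + g) * c'"
    and f': "entropic_endo f'" "f' - 1 \<in> endos_in m" "c'' - C * f' \<in> endos_in (ideal_power m (Suc (Suc k)))"
    using entropic_improvement[OF m is_ideal_ideal_power is_ideal_ideal_power ideal_power_Suc_subset(1)[OF m]
        ideal_power_Suc_mult inverse c'(1) f] by blast
  have T: "tens2 ((1 + g) * \<beta>) = tens2 (1 + g) * tens2 \<beta>" by (simp add: tens_mult)
  have "c'' * (tens2 (1 + g) * tens2 \<beta>) = tens2 (1 + g) * (c' * tens2 \<beta>)"
    unfolding mult.assoc[symmetric] c''(2) ..
  also have "\<dots> = tens2 (1 + g) * tens2 \<beta> * c"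
    unfolding c'(2) mult.assoc ..
  finally have "c'' * tens2 ((1 + g) * \<beta>) = tens2 ((1 + g) * \<beta>) * c" unfolding T .
  moreover have "(1 + g) * \<beta> - 1 \<in> endos_in m"
  proof -
    have "g \<in> endos_in m" using g endos_in_mono[OF ideal_power_Suc_subset(1)[OF m]] by blast
    then show ?thesis
      using two_sided_add[OF Km \<beta> two_sided_right[OF Km, of g \<beta>]] by (simp add: algebra_simps)
  qed
  moreover have "(1 + g) * \<beta> - \<beta> \<in> endos_in (ideal_power m k)"
  proof -
    have "g \<in> endos_in (ideal_power m k)" using g endos_in_mono[OF ideal_power_Suc_subset(2)[OF m]] by blast
    then show ?thesis using two_sided_right[OF K, where a = g and c = \<beta>] by (simp add: algebra_simps)
  qed
  ultimately show "\<exists>\<beta>'. entropic_modulo (ideal_power m (Suc (Suc k))) m c \<beta>' \<and> \<beta>' - \<beta> \<in> endos_in (ideal_power m k)"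
    unfolding entropic_modulo_def using c''(1) f' by blast
qed

lemma entropic_limit:
  assumes ring: "adic_complete ((*) :: 'a \<Rightarrow> 'a \<Rightarrow> 'a) m"
    and close: "\<And>k. \<exists>fk. entropic_endo fk \<and> f - fk \<in> endos_in (ideal_power m k)"
  shows "entropic_endo f"
proof -
  have separated: "a = b" if "\<And>k. a - b \<in> ideal_power m k" for a b :: 'a
    using ring that unfolding adic_complete_iff[OF module_times] ideal_times_self[OF is_ideal_ideal_power]
    by (metis eq_iff_diff_eq_0)
  show ?thesis
    unfolding entropic_endo_def entropic_kernel_def
  proof (intro conjI allI ballI impI)
    fix x0 x1 y0 y1 v w assume vw: "v \<in> G" "w \<in> G"
    show "coef f (v x0, w x1) (v y0, w y1) = coef f (x0, x1) (y0, y1)"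
    proof (rule separated)
      fix k
      obtain fk where fk: "entropic_endo fk" "f - fk \<in> endos_in (ideal_power m k)" using close[of k] by blast
      show "coef f (v x0, w x1) (v y0, w y1) - coef f (x0, x1) (y0, y1) \<in> ideal_power m k"
        using module.subspace_diff[OF module_times is_ideal_ideal_power
            coef_endos_in[OF fk(2), of "(v x0, w x1)" "(v y0, w y1)"] coef_endos_in[OF fk(2), of "(x0, x1)" "(y0, y1)"]]
        by (simp add: coef_simps entropic_Inn[OF fk(1) vw])
    qed
  next
    fix x0 x1 y0 y1 assume "coef f (x0, x1) (y0, y1) \<noteq> 0"
    then obtain k where k: "coef f (x0, x1) (y0, y1) - 0 \<notin> ideal_power m k" using separated by blast
    obtain fk where fk: "entropic_endo fk" "f - fk \<in> endos_in (ideal_power m k)" using close[of k] by blast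
    have "coef fk (x0, x1) (y0, y1) \<noteq> 0"
      using k coef_endos_in[OF fk(2), of "(x0, x1)" "(y0, y1)"] by (auto simp: coef_simps)
    then show "alike x0 y0" "alike x1 y1" using entropic_zero[OF fk(1)] by blast+
  qed
qed

text \<open>The entropic map is defined from the limit of the changes of basis alone. That it is entropic then follows
from the approximations, to the \<open>k\<close>-th of which it is congruent modulo \<open>m\<^sup>k\<close>.\<close>

lemma conjugate_to_entropic:
  assumes m: "is_ideal m" and ring: "adic_complete ((*) :: 'a \<Rightarrow> 'a \<Rightarrow> 'a) m"
    and module: "adic_complete (fscale :: 'a \<Rightarrow> ('q \<Rightarrow>\<^sub>0 'a) \<Rightarrow> ('q \<Rightarrow>\<^sub>0 'a)) m"
    and yb: "yang_baxter_endo c" and cC: "c - C \<in> endos_in m"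
  obtains \<beta> b f where "\<beta> - 1 \<in> endos_in m" "b * \<beta> = 1" "\<beta> * b = 1"
    "entropic_endo f" "f - 1 \<in> endos_in m" "C * f * tens2 \<beta> = tens2 \<beta> * c"
proof -
  let ?K = "\<lambda>n. endos_in (ideal_power m n)"
  note K = endos_in_two_sided[OF is_ideal_ideal_power] and Km = endos_in_two_sided[OF m]
  have inverse: "\<exists>b. b * (1 + g) = 1 \<and> (1 + g) * b = 1" if "g \<in> endos_in m" for g :: "('q, 'a) endo"
    by (rule neumann_inverse[OF m ring module that])
  from entropic_approximations[OF m inverse yb cC]
  obtain \<beta>s where approx: "\<And>k. entropic_modulo (ideal_power m (Suc k)) m c (\<beta>s k)"
    and "\<And>k. \<beta>s (Suc k) - \<beta>s k \<in> ?K k" by blast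
  then obtain \<beta> where \<beta>: "\<And>k. \<beta> - \<beta>s k \<in> ?K k" using endo_limit[OF module] by blast
  have "\<beta> - 1 = (\<beta> - \<beta>s (Suc 0)) + (\<beta>s (Suc 0) - 1)" by simp
  moreover have "\<beta> - \<beta>s (Suc 0) \<in> endos_in m"
    using \<beta>[of "Suc 0"] endos_in_mono[OF ideal_power_Suc_subset(1)[OF m]] by blast
  ultimately have \<beta>1: "\<beta> - 1 \<in> endos_in m"
    using two_sided_add[OF Km] approx[of "Suc 0"] by (metis entropic_modulo_def)
  then obtain b where b: "b * \<beta> = 1" "\<beta> * b = 1" using inverse[of "\<beta> - 1"] by auto
  have TT: "tens2 \<beta> * tens2 b = 1" "tens2 b * tens2 \<beta> = 1"
    by (simp_all add: tens_mult b tens_one)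
  define c' where "c' = tens2 \<beta> * c * tens2 b"
  have c'T: "c' * tens2 \<beta> = tens2 \<beta> * c" by (simp add: c'_def mult.assoc TT)
  define f where "f = perm (inv_into UNIV braid) * c'"
  have c'f: "c' = C * f" using C_inverse(2) by (simp add: f_def flip: mult.assoc)
  have close: "\<exists>fk. entropic_endo fk \<and> fk - 1 \<in> endos_in m \<and> f - fk \<in> ?K k" for k
  proof -
    obtain ck fk where ck: "ck * tens2 (\<beta>s k) = tens2 (\<beta>s k) * c"
      and fk: "entropic_endo fk" "fk - 1 \<in> endos_in m" "ck - C * fk \<in> ?K (Suc k)"
      using approx[of k] unfolding entropic_modulo_def by blast
    have "tens2 \<beta> - tens2 (\<beta>s k) = tens (\<beta> - \<beta>s k) \<beta> + tens (\<beta>s k) (\<beta> - \<beta>s k)"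
      by (rule endo_eqI) (clarsimp simp: coef_tens coef_simps algebra_simps)
    then have T: "tens2 \<beta> - tens2 (\<beta>s k) \<in> ?K k"
      using two_sided_add[OF K] tens_endos_in[OF is_ideal_ideal_power \<beta>] by metis
    have "(c' - ck) * tens2 \<beta> = (tens2 \<beta> - tens2 (\<beta>s k)) * c - ck * (tens2 \<beta> - tens2 (\<beta>s k))"
      using c'T ck by (simp add: algebra_simps)
    then have "(c' - ck) * tens2 \<beta> * tens2 b \<in> ?K k"
      using T by (metis two_sided_diff[OF K] two_sided_left[OF K] two_sided_right[OF K])
    then have "c' - ck \<in> ?K k" by (simp add: mult.assoc TT)
    moreover have "ck - C * fk \<in> ?K k" using fk(3) endos_in_mono[OF ideal_power_Suc_subset(2)[OF m]] by blast
    ultimately have "c' - C * fk \<in> ?K k" using two_sided_add[OF K, where a = "c' - ck" and b = "ck - C * fk"] by simp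
    moreover have "f - fk = perm (inv_into UNIV braid) * (c' - C * fk)"
      using C_inverse(1) by (simp add: f_def right_diff_distrib flip: mult.assoc)
    ultimately show ?thesis using fk(1,2) two_sided_left[OF K] by metis
  qed
  obtain f1 where f1: "f1 - 1 \<in> endos_in m" "f - f1 \<in> ?K (Suc 0)" using close[of "Suc 0"] by blast
  have "f - f1 \<in> endos_in m" using f1(2) endos_in_mono[OF ideal_power_Suc_subset(1)[OF m]] by blast
  from two_sided_add[OF Km this f1(1)] have f_id: "f - 1 \<in> endos_in m" by simp
  have "entropic_endo f" using close by (intro entropic_limit[OF ring]) blast
  then show thesis using that[OF \<beta>1 b _ f_id] c'T unfolding c'f by blast
qed

end

theorem theorem16:
  fixes m :: "'a::comm_ring_1 set"
    and r :: "'q \<Rightarrow> 'q \<Rightarrow> 'q"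
    and c :: "('q \<times> 'q \<Rightarrow>\<^sub>0 'a) \<Rightarrow> ('q \<times> 'q \<Rightarrow>\<^sub>0 'a)"
  assumes "is_ideal m"
    and "adic_complete ((*) :: 'a \<Rightarrow> 'a \<Rightarrow> 'a) m"
    and "adic_complete (fscale :: 'a \<Rightarrow> ('q \<Rightarrow>\<^sub>0 'a) \<Rightarrow> ('q \<Rightarrow>\<^sub>0 'a)) m"
    and "rack r"
    and "finite (rack_Inn r)"
    and "(of_nat (card (rack_Inn r)) :: 'a) dvd 1"
    and "yb_deformation m (rack_op r) c"
  shows "\<exists>c'. entropic_deformation m r c' \<and> yb_equivalent m c c'"
proof -
  note m = assms(1)
  obtain \<nu> :: 'a where "of_nat (card (rack_Inn r)) * \<nu> = 1" using assms(6) by (metis dvdE)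
  then interpret finite_inner_rack r \<nu> using assms(4,5) by unfold_locales
  define c0 where "c0 = endo c"
  have c: "flinear c" "bij c" "yang_baxter c" "cong_maps m c (rack_op r)"
    using assms(7) by (auto simp: yb_deformation_def yang_baxter_def automorphism_def)
  have app_c0: "app c0 = c" using c(1) by (simp add: c0_def endo_inverse)
  have yang_baxter_app: "yang_baxter (app f) \<longleftrightarrow> bij (app f) \<and> yang_baxter_endo f" for f :: "('q \<times> 'q, 'a) endo"
    unfolding yang_baxter_def yang_baxter_endo_def automorphism_def app_inject[symmetric]
      app_first[symmetric] app_final[symmetric] by (simp add: fun_eq_iff app_simps)
  have yb0: "yang_baxter_endo c0" using c(3) yang_baxter_app[of c0] app_c0 by simp
  have cC: "c0 - C \<in> endos_in m"
    using c(4) cong_maps_iff_endos_in[OF m, of c0 C] by (simp add: app_c0 app_C)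
  obtain \<beta> b f where \<beta>: "\<beta> - 1 \<in> endos_in m" and b: "b * \<beta> = 1" "\<beta> * b = 1"
    and f: "entropic_endo f" "f - 1 \<in> endos_in m" and intertwines: "C * f * tens2 \<beta> = tens2 \<beta> * c0"
    using conjugate_to_entropic[OF m assms(2,3) yb0 cC] by blast
  have TT: "tens2 \<beta> * tens2 b = 1" "tens2 b * tens2 \<beta> = 1"
    by (simp_all add: tens_mult b tens_one)
  have c': "C * f = tens2 \<beta> * c0 * tens2 b"
    unfolding intertwines[symmetric] by (simp add: mult.assoc TT)
  have id: "app 1 = (id :: ('x \<Rightarrow>\<^sub>0 'a) \<Rightarrow> _)" by (simp add: fun_eq_iff app_simps)
  have comp: "app (x * y) = app x \<circ> app y" for x y :: "('x, 'a) endo" by (simp add: fun_eq_iff app_simps)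
  have bij: "bij (app x)" if "x * y = 1" "y * x = 1" for x y :: "('x, 'a) endo"
    using o_bij[of "app y" "app x"] that by (simp add: id flip: comp)
  have "inv_into UNIV (app (tens2 \<beta>)) = app (tens2 b)"
    using inv_unique_comp[of "app (tens2 \<beta>)" "app (tens2 b)"] TT by (simp add: id flip: comp)
  moreover have "app (tens2 \<beta>) = tensor_map (app \<beta>) (app \<beta>)" by (rule tens.rep_eq)
  ultimately have conj: "app (C * f) = tensor_map (app \<beta>) (app \<beta>) \<circ> c \<circ> inv_into UNIV (tensor_map (app \<beta>) (app \<beta>))"
    by (simp add: c' comp app_c0)
  have "bij (app (C * f))"
    unfolding c' comp app_c0 using bij[OF TT] bij[OF TT(2,1)] c(2) by (intro bij_comp)
  then have "yang_baxter (app (C * f))"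
    using yang_baxter_app yang_baxter_conjugate[OF yb0 intertwines b(2)] by blast
  moreover have "automorphism (app \<beta>)"
    using bij[OF b(2,1)] by (simp add: automorphism_def)
  moreover have "cong_maps m (app \<beta>) id" "cong_maps m (app f) id"
    using cong_maps_iff_endos_in[OF m, of \<beta> 1] cong_maps_iff_endos_in[OF m, of f 1] \<beta> f(2)
    by (simp_all add: id)
  moreover have "app (C * f) = rack_op r \<circ> app f"
    by (simp add: comp app_C)
  ultimately have "entropic_deformation m r (app (C * f)) \<and> yb_equivalent m c (app (C * f))"
    unfolding entropic_deformation_def yb_equivalent_def
    using entropic_of_entropic_endo[OF f(1)] c(3) conj by blast
  then show ?thesis by blast
qed

end
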